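(* Let $(X_i,Y_i,Z_i)_{i\ge1}$ be i.i.d. with law $P$ on $\mathbb R\times\mathbb R\times\mathbb R^d$, $d\ge1$, let $\mathcal H$ be a separable reproducing kernel Hilbert space of functions $\mathbb R^d\to\mathbb R$ with kernel $K$, and let $\epsilon_X(Z),\epsilon_Y(Z)$, $f,g$, the regression estimators $\widehat f,\widehat g$ and the residuals $\widehat\epsilon_{X_i}(Z_i),\widehat\epsilon_{Y_i}(Z_i)$ be as in the context. Assume: (i) $A_f=\frac1n\sum_{i=1}^n(f(Z_i)-\widehat f(Z_i))^2=o_p(n^{-1/2})$ and $A_g=\frac1n\sum_{i=1}^n(g(Z_i)-\widehat g(Z_i))^2=o_p(n^{-1/2})$; (ii) $u_f(z,y)=\mathbb E(\epsilon_X(Z)^2\mid Z=z,Y=y)$ and $v_g(z,x)=\mathbb E(\epsilon_Y(Z)^2\mid Z=z,X=x)$ are uniformly bounded; (iii) $0<\mathbb E(\epsilon_X(Z)^2\epsilon_Y(Z)^2)$; (iv) there is a constant $C>0$ with $|K(z,z')|\le C$ for all $z,z'\in\mathbb R^d$. Let $$\Psi_n=\sup_{\omega\in\mathcal H:\|\omega\|_{\mathcal H}=1}S_n(\omega)^2,\qquad S_n(\omega)=\frac1{\sqrt n}\sum_{i=1}^n\omega(Z_i)\,\widehat\epsilon_{X_i}(Z_i)\,\widehat\epsilon_{Y_i}(Z_i).$$ Then, under the alternative hypothesis that $X$ and $Y$ are not conditionally independent given $Z$, there exists a constant $c^\star\in\mathbb R$ such that $\frac1n\Psi_n\to(c^\star)^2$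 in probability as $n\to\infty$. Moreover, if there exists a measurable set $A\subseteq\mathbb R^d$ such that $\mathbb E(\epsilon_X(Z)\epsilon_Y(Z)\mid Z)\ne0$ for $Z\in A$, and $\mathcal H$ is $c_0$-universal, then $c^\star\ne0$.
   Context: $(X,Y,Z)\sim P$ with $X,Y$ integrable; $f(z)=\mathbb E(X\mid Z=z)$, $g(z)=\mathbb E(Y\mid Z=z)$, $\epsilon_X(Z)=X-f(Z)$, $\epsilon_Y(Z)=Y-g(Z)$. For each $n$, $\widehat f$ is a regression estimator of $f$ computed from $(X_i,Z_i)_{i=1}^n$, and $\widehat g$ is a regression estimator of $g$ computed from $(Y_i,Z_i)_{i=1}^n$. Residuals: $\widehat\epsilon_{X_i}(Z_i)=X_i-\widehat f(Z_i)$, $\widehat\epsilon_{Y_i}(Z_i)=Y_i-\widehat g(Z_i)$. Functions in $\mathcal H$ are Borel measurable. $c_0$-universality: an RKHS $\mathcal H$ on a locally compact Hausdorff space $\mathcal X$ (here $\mathbb R^d$) with kernel $K$ that is bounded and such that $K(x,\cdot)\in C_0(\mathcal X)$ (continuous, vanishing at infinity) for all $x$ is $c_0$-universal if and only if every bounded signed measure $\mu\neq0$ on $\mathcal X$ satisfies $\sup_{\omega\in\mathcal H:\|\omega\|_{\mathcal H}=1}\int\omega(x)\,\mu(dx)>0$.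
   Formalization: In the "moreover" part the measurable set A is required to satisfy P(Z∈A)>0 (with the conditional expectation nonzero for almost every Z in A); for A empty or of probability zero the claim c*≠0 is false. *)

theory Defs
  imports "HOL-Probability.Probability"
begin

section \<open>Convergence in probability\<close>

text \<open>Measurability is part of the definition, since \<^const>\<open>measure\<close> is 0 on non-measurable sets.\<close>

definition converges_in_prob :: "'a measure \<Rightarrow> (nat \<Rightarrow> 'a \<Rightarrow> real) \<Rightarrow> real \<Rightarrow> bool" where
  "converges_in_prob M U c \<longleftrightarrow>
     (\<forall>n. U n \<in> borel_measurable M) \<and>
     (\<forall>e>0. (\<lambda>n. measure M {w \<in> space M. \<bar>U n w - c\<bar> > e}) \<longlonglongrightarrow> 0)"

definition small_o_p :: "'a measure \<Rightarrow> (nat \<Rightarrow> 'a \<Rightarrow> real) \<Rightarrow> (nat \<Rightarrow> real) \<Rightarrow> bool" where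
  "small_o_p M U r \<longleftrightarrow> converges_in_prob M (\<lambda>n w. U n w / r n) 0"


section \<open>Conditioning on a random variable\<close>

abbreviation sigma_gen :: "'a measure \<Rightarrow> ('a \<Rightarrow> 'b::topological_space) \<Rightarrow> 'a measure" where
  "sigma_gen P V \<equiv> vimage_algebra (space P) V borel"

text \<open>\<open>h\<close> is a version of the map \<open>v \<mapsto> E(W | V = v)\<close>, for integrable \<open>W\<close>.\<close>

definition cond_exp_version ::
  "'a measure \<Rightarrow> ('a \<Rightarrow> 'b::topological_space) \<Rightarrow> ('a \<Rightarrow> real) \<Rightarrow> ('b \<Rightarrow> real) \<Rightarrow> bool" where
  "cond_exp_version P V W h \<longleftrightarrow>
     h \<in> borel_measurable borel \<and>
     (AE w in P. h (V w) = real_cond_exp P (sigma_gen P V) W w)"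

text \<open>The same for nonnegative \<open>W\<close>, with values in \<open>[0, \<infinity>]\<close>.  For non-integrable \<open>W\<close> the real
  version would turn the value \<open>\<infinity>\<close> into 0, so that boundedness could hold spuriously.\<close>

definition nn_cond_exp_version ::
  "'a measure \<Rightarrow> ('a \<Rightarrow> 'b::topological_space) \<Rightarrow> ('a \<Rightarrow> ennreal) \<Rightarrow> ('b \<Rightarrow> ennreal) \<Rightarrow> bool" where
  "nn_cond_exp_version P V W h \<longleftrightarrow>
     h \<in> borel_measurable borel \<and>
     (AE w in P. h (V w) = nn_cond_exp P (sigma_gen P V) W w)"

definition cond_indep ::
  "'a measure \<Rightarrow> ('a \<Rightarrow> real) \<Rightarrow> ('a \<Rightarrow> real) \<Rightarrow> ('a \<Rightarrow> 'b::topological_space) \<Rightarrow> bool" where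
  "cond_indep P X Y Z \<longleftrightarrow>
     (\<forall>A \<in> sets borel. \<forall>B \<in> sets borel. AE w in P.
        real_cond_exp P (sigma_gen P Z) (\<lambda>w. indicator A (X w) * indicator B (Y w)) w =
        real_cond_exp P (sigma_gen P Z) (\<lambda>w. indicator A (X w)) w *
        real_cond_exp P (sigma_gen P Z) (\<lambda>w. indicator B (Y w)) w)"


section \<open>Reproducing kernel Hilbert spaces\<close>

definition ip_norm :: "(('b \<Rightarrow> real) \<Rightarrow> ('b \<Rightarrow> real) \<Rightarrow> real) \<Rightarrow> ('b \<Rightarrow> real) \<Rightarrow> real" where
  "ip_norm ip h = sqrt (ip h h)"

locale inner_product_function_space =
  fixes H :: "('b \<Rightarrow> real) set"
    and ip :: "('b \<Rightarrow> real) \<Rightarrow> ('b \<Rightarrow> real) \<Rightarrow> real"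
  assumes zero_in: "(\<lambda>x. 0) \<in> H"
    and add_in: "h \<in> H \<Longrightarrow> h' \<in> H \<Longrightarrow> (\<lambda>x. h x + h' x) \<in> H"
    and scale_in: "h \<in> H \<Longrightarrow> (\<lambda>x. c * h x) \<in> H"
    and ip_commute: "h \<in> H \<Longrightarrow> h' \<in> H \<Longrightarrow> ip h h' = ip h' h"
    and ip_add_left: "h \<in> H \<Longrightarrow> h' \<in> H \<Longrightarrow> k \<in> H \<Longrightarrow> ip (\<lambda>x. h x + h' x) k = ip h k + ip h' k"
    and ip_scale_left: "h \<in> H \<Longrightarrow> k \<in> H \<Longrightarrow> ip (\<lambda>x. c * h x) k = c * ip h k"
    and ip_nonneg: "h \<in> H \<Longrightarrow> 0 \<le> ip h h"
    and ip_definite: "h \<in> H \<Longrightarrow> ip h h = 0 \<Longrightarrow> h = (\<lambda>x. 0)"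
begin

text \<open>The value outside \<open>H\<close> is irrelevant; 0 makes it fit \<^locale>\<open>Metric_space\<close>, which asks for
  symmetry and nonnegativity on the whole type.\<close>

definition ip_dist :: "('b \<Rightarrow> real) \<Rightarrow> ('b \<Rightarrow> real) \<Rightarrow> real" where
  "ip_dist h h' = (if h \<in> H \<and> h' \<in> H then ip_norm ip (\<lambda>x. h x - h' x) else 0)"

lemma diff_in: "h \<in> H \<Longrightarrow> h' \<in> H \<Longrightarrow> (\<lambda>x. h x - h' x) \<in> H"
  using add_in[of h "\<lambda>x. (-1) * h' x"] scale_in[of h' "-1"] by simp

lemma ip_add_right: "h \<in> H \<Longrightarrow> h' \<in> H \<Longrightarrow> k \<in> H \<Longrightarrow> ip k (\<lambda>x. h x + h' x) = ip k h + ip k h'"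
  using ip_add_left[of h h' k] ip_commute add_in by metis

lemma ip_scale_right: "h \<in> H \<Longrightarrow> k \<in> H \<Longrightarrow> ip k (\<lambda>x. c * h x) = c * ip k h"
  using ip_scale_left[of h k c] ip_commute scale_in by metis

lemma ip_comb:
  assumes "h \<in> H" "k \<in> H"
  shows "ip (\<lambda>x. h x + c * k x) (\<lambda>x. h x + c * k x) = ip h h + 2 * c * ip h k + c\<^sup>2 * ip k k"
proof -
  have s: "(\<lambda>x. c * k x) \<in> H" using scale_in assms by blast
  have a: "(\<lambda>x. h x + c * k x) \<in> H" using add_in[OF assms(1) s] .
  show ?thesis
    by (simp add: ip_add_left[OF assms(1) s a] ip_add_right[OF assms(1) s assms(1)]
        ip_add_right[OF assms(1) s s] ip_scale_left[OF assms(2)] ip_scale_right[OF assms(2)]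
        s assms ip_commute[OF assms(2,1)] power2_eq_square algebra_simps)
qed

lemma Cauchy_Schwarz_ip:
  assumes "h \<in> H" "k \<in> H"
  shows "ip h k \<le> ip_norm ip h * ip_norm ip k"
proof (cases "ip k k = 0")
  case True
  then have "k = (\<lambda>x. 0 * k x)" using ip_definite assms by auto
  then have "ip h k = 0" using ip_scale_right[OF assms(2,1), of 0] by simp
  then show ?thesis by (simp add: ip_norm_def assms ip_nonneg)
next
  case False
  then have p: "ip k k > 0" using ip_nonneg[OF assms(2)] by simp
  define c where "c = - (ip h k / ip k k)"
  have "0 \<le> ip h h + 2 * c * ip h k + c\<^sup>2 * ip k k"
    using ip_nonneg[OF add_in[OF assms(1) scale_in[OF assms(2), of c]]] ip_comb[OF assms, of c]
    by simp
  also have "\<dots> = ip h h - (ip h k)\<^sup>2 / ip k k"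
    using p by (simp add: c_def power2_eq_square field_simps)
  finally have "(ip h k)\<^sup>2 \<le> ip h h * ip k k" using p by (simp add: field_simps)
  then show ?thesis by (simp add: ip_norm_def real_sqrt_mult[symmetric] real_le_rsqrt)
qed

lemma ip_norm_triangle:
  assumes "h \<in> H" "k \<in> H"
  shows "ip_norm ip (\<lambda>x. h x + k x) \<le> ip_norm ip h + ip_norm ip k"
proof -
  have "ip (\<lambda>x. h x + k x) (\<lambda>x. h x + k x) = ip h h + 2 * ip h k + ip k k"
    using ip_comb[OF assms, of 1] by simp
  also have "\<dots> \<le> (ip_norm ip h + ip_norm ip k)\<^sup>2"
    using Cauchy_Schwarz_ip[OF assms] assms ip_nonneg
    by (simp add: power2_sum) (simp add: ip_norm_def)
  finally show ?thesis
    using assms ip_nonneg by (simp add: ip_norm_def real_le_lsqrt)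
qed

sublocale Metric_space H ip_dist
proof
  show "0 \<le> ip_dist x y" for x y
    by (auto simp: ip_dist_def ip_norm_def diff_in ip_nonneg)
  show "ip_dist x y = ip_dist y x" for x y
  proof (cases "x \<in> H \<and> y \<in> H")
    case True
    then have d: "(\<lambda>t. x t - y t) \<in> H" by (simp add: diff_in)
    have "(\<lambda>t. y t - x t) = (\<lambda>t. (-1) * (x t - y t))" by auto
    moreover have "ip (\<lambda>t. (-1) * (x t - y t)) (\<lambda>t. (-1) * (x t - y t))
        = ip (\<lambda>t. x t - y t) (\<lambda>t. x t - y t)"
      using ip_scale_left[OF d scale_in[OF d, of "-1"], of "-1"] ip_scale_right[OF d d, of "-1"]
      by simp
    ultimately show ?thesis using True by (simp add: ip_dist_def ip_norm_def)
  qed (auto simp: ip_dist_def)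
  show "ip_dist x y = 0 \<longleftrightarrow> x = y" if "x \<in> H" "y \<in> H" for x y
  proof
    assume "ip_dist x y = 0"
    then have "ip (\<lambda>t. x t - y t) (\<lambda>t. x t - y t) = 0"
      using that by (simp add: ip_dist_def ip_norm_def)
    then have "(\<lambda>t. x t - y t) = (\<lambda>t. 0)" using ip_definite diff_in that by blast
    then show "x = y" by (auto simp: fun_eq_iff)
  next
    assume "x = y"
    then show "ip_dist x y = 0"
      using that ip_scale_left[OF zero_in zero_in, of 0] by (simp add: ip_dist_def ip_norm_def)
  qed
  show "ip_dist x z \<le> ip_dist x y + ip_dist y z" if "x \<in> H" "y \<in> H" "z \<in> H" for x y z
    using ip_norm_triangle[OF diff_in[OF that(1,2)] diff_in[OF that(2,3)]] that
    by (simp add: ip_dist_def)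
qed

end

locale rkhs = inner_product_function_space H ip
  for H :: "('b \<Rightarrow> real) set" and ip +
  fixes K :: "'b \<Rightarrow> 'b \<Rightarrow> real"
  assumes complete: "mcomplete"
    and kernel_in: "K x \<in> H"
    and reproducing: "h \<in> H \<Longrightarrow> ip h (K x) = h x"

locale separable_rkhs = rkhs +
  assumes separable: "separable_space mtopology"


section \<open>Finite signed measures\<close>

definition finite_signed_measure :: "'b measure \<Rightarrow> ('b set \<Rightarrow> real) \<Rightarrow> bool" where
  "finite_signed_measure N \<mu> \<longleftrightarrow>
     (\<forall>A::nat \<Rightarrow> 'b set. range A \<subseteq> sets N \<longrightarrow> disjoint_family A \<longrightarrow>
        (\<lambda>i. \<mu> (A i)) sums \<mu> (\<Union>i. A i))"

text \<open>The positive part of the Jordan decomposition; the negative part is that of \<open>-\<mu>\<close>.\<close>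

definition positive_variation :: "'b measure \<Rightarrow> ('b set \<Rightarrow> real) \<Rightarrow> 'b measure" where
  "positive_variation N \<mu> =
     measure_of (space N) (sets N) (\<lambda>A. SUP B\<in>{B \<in> sets N. B \<subseteq> A}. ennreal (\<mu> B))"

definition signed_integral :: "'b measure \<Rightarrow> ('b set \<Rightarrow> real) \<Rightarrow> ('b \<Rightarrow> real) \<Rightarrow> real" where
  "signed_integral N \<mu> h =
     (\<integral>x. h x \<partial>positive_variation N \<mu>) - (\<integral>x. h x \<partial>positive_variation N (\<lambda>A. - \<mu> A))"

lemma finite_signed_measure_empty:
  assumes "finite_signed_measure N \<mu>" shows "\<mu> {} = 0"
proof -
  have "(\<lambda>i::nat. \<mu> {}) sums \<mu> {}"
    using assms[unfolded finite_signed_measure_def, rule_format, of "\<lambda>_. {}"]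
    by (simp add: disjoint_family_on_def)
  then show ?thesis using sums_summable summable_const_iff by blast
qed

lemma finite_signed_measure_Un:
  assumes "finite_signed_measure N \<mu>" "A \<in> sets N" "B \<in> sets N" "A \<inter> B = {}"
  shows "\<mu> (A \<union> B) = \<mu> A + \<mu> B"
proof -
  have "(\<lambda>i. \<mu> (binaryset A B i)) sums \<mu> (\<Union>i. binaryset A B i)"
    using assms by (intro assms(1)[unfolded finite_signed_measure_def, rule_format])
      (auto simp: binaryset_def disjoint_family_on_def)
  moreover have "(\<lambda>i. \<mu> (binaryset A B i)) sums (\<mu> A + \<mu> B)"
    by (rule binaryset_sums) (rule finite_signed_measure_empty[OF assms(1)])
  ultimately show ?thesis using sums_unique2 by (metis UN_binaryset_eq)
qed

text \<open>The set function in \<^const>\<open>positive_variation\<close> is indeed a measure.\<close>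

lemma emeasure_positive_variation:
  assumes \<mu>: "finite_signed_measure N \<mu>" and A: "A \<in> sets N"
  shows "emeasure (positive_variation N \<mu>) A = (SUP B\<in>{B \<in> sets N. B \<subseteq> A}. ennreal (\<mu> B))"
proof -
  define F where "F A = (SUP B\<in>{B \<in> sets N. B \<subseteq> A}. ennreal (\<mu> B))" for A
  have emp: "\<mu> {} = 0" by (rule finite_signed_measure_empty[OF \<mu>])
  have F0: "F {} = 0"
  proof -
    have "{B \<in> sets N. B \<subseteq> {}} = {{}}" by auto
    then show ?thesis by (simp add: F_def emp)
  qed
  have up: "ennreal (\<mu> B) \<le> F A" if "B \<in> sets N" "B \<subseteq> A" for A B
    unfolding F_def using that by (intro SUP_upper) auto
  have add_le: "F A + F B \<le> F (A \<union> B)" if "A \<inter> B = {}" for A B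
  proof -
    have ne: "{C \<in> sets N. C \<subseteq> D} \<noteq> {}" for D by auto
    have "ennreal (\<mu> C) + ennreal (\<mu> D) \<le> F (A \<union> B)"
      if C: "C \<in> sets N" "C \<subseteq> A" and D: "D \<in> sets N" "D \<subseteq> B" for C D
    proof -
      have un: "\<mu> (C \<union> D) = \<mu> C + \<mu> D"
        using \<open>A \<inter> B = {}\<close> C D by (intro finite_signed_measure_Un[OF \<mu>]) auto
      have u1: "ennreal (\<mu> C) \<le> F (A \<union> B)" "ennreal (\<mu> D) \<le> F (A \<union> B)"
        "ennreal (\<mu> C + \<mu> D) \<le> F (A \<union> B)"
        using C D by (auto intro!: up simp flip: un)
      show ?thesis
      proof (cases "\<mu> C \<ge> 0 \<and> \<mu> D \<ge> 0")
        case True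
        then show ?thesis using u1(3) by (simp add: ennreal_plus)
      next
        case False
        then have "ennreal (\<mu> C) = 0 \<or> ennreal (\<mu> D) = 0" by (auto simp: ennreal_eq_0_iff)
        then show ?thesis using u1 by auto
      qed
    qed
    then have "F A + ennreal (\<mu> D) \<le> F (A \<union> B)" if "D \<in> sets N" "D \<subseteq> B" for D
      unfolding F_def[of A] ennreal_SUP_add_left[OF ne, symmetric] using that
      by (intro SUP_least) auto
    then show ?thesis
      unfolding F_def[of B] ennreal_SUP_add_right[OF ne] by (intro SUP_least) auto
  qed
  have mono: "F A \<le> F B" if "A \<subseteq> B" for A B
    unfolding F_def using that by (intro SUP_subset_mono) auto
  have ca: "countably_additive (sets N) F"
  proof (rule countably_additiveI)
    fix A :: "nat \<Rightarrow> _" assume A: "range A \<subseteq> sets N" "disjoint_family A" "\<Union> (range A) \<in> sets N"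
    have fin: "(\<Sum>i<n. F (A i)) \<le> F (\<Union>i<n. A i)" for n
    proof (induction n)
      case (Suc n)
      have "(\<Union>i<n. A i) \<inter> A n = {}"
        using A(2) by (auto simp: disjoint_family_on_def) (metis disjoint_iff less_irrefl)
      then have "F (\<Union>i<n. A i) + F (A n) \<le> F ((\<Union>i<n. A i) \<union> A n)" by (rule add_le)
      moreover have "(\<Union>i<n. A i) \<union> A n = (\<Union>i<Suc n. A i)" by (auto simp: lessThan_Suc)
      ultimately show ?case using Suc.IH by (simp add: add.commute) (meson add_left_mono order_trans)
    qed (simp add: F0)
    have 1: "(\<Sum>i. F (A i)) \<le> F (\<Union>i. A i)"
      by (intro suminf_le_const) (auto intro: order_trans[OF fin] mono)
    have 2: "F (\<Union>i. A i) \<le> (\<Sum>i. F (A i))"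
      unfolding F_def[of "\<Union>i. A i"]
    proof (intro SUP_least, clarify)
      fix B assume B: "B \<in> sets N" "B \<subseteq> (\<Union>i. A i)"
      have "(\<lambda>i. \<mu> (B \<inter> A i)) sums \<mu> (\<Union>i. B \<inter> A i)"
        using A B by (intro \<mu>[unfolded finite_signed_measure_def, rule_format])
          (auto simp: disjoint_family_on_def)
      moreover have "(\<Union>i. B \<inter> A i) = B" using B by auto
      ultimately have s: "(\<lambda>i. \<mu> (B \<inter> A i)) sums \<mu> B" by simp
      then have "(\<lambda>n. ennreal (\<Sum>i<n. \<mu> (B \<inter> A i))) \<longlonglongrightarrow> ennreal (\<mu> B)"
        unfolding sums_def by (rule tendsto_ennrealI)
      moreover have "ennreal (\<Sum>i<n. \<mu> (B \<inter> A i)) \<le> (\<Sum>i. F (A i))" for n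
      proof -
        have "ennreal (\<Sum>i<n. \<mu> (B \<inter> A i)) \<le> ennreal (\<Sum>i<n. max 0 (\<mu> (B \<inter> A i)))"
          by (intro ennreal_leI sum_mono) auto
        also have "\<dots> = (\<Sum>i<n. ennreal (\<mu> (B \<inter> A i)))"
          by (subst sum_ennreal[symmetric]) (auto simp: ennreal_max_0)
        also have "\<dots> \<le> (\<Sum>i<n. F (A i))" using A B by (intro sum_mono up) auto
        also have "\<dots> \<le> (\<Sum>i. F (A i))" by (intro sum_le_suminf) auto
        finally show ?thesis .
      qed
      ultimately show "ennreal (\<mu> B) \<le> (\<Sum>i. F (A i))"
        by (intro LIMSEQ_le_const2) auto
    qed
    show "(\<Sum>i. F (A i)) = F (\<Union> (range A))" using 1 2 by simp
  qed
  have "emeasure (positive_variation N \<mu>) A = F A"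
    unfolding positive_variation_def F_def[symmetric]
    using A ca F0 sets.space_closed sets.sigma_algebra_axioms
    by (intro emeasure_measure_of_sigma) (auto simp: positive_def)
  then show ?thesis by (simp add: F_def)
qed


section \<open>Universality\<close>

text \<open>The supremum is taken in \<^typ>\<open>ereal\<close>, so that it is \<open>-\<infinity>\<close>, hence not positive, when \<open>H\<close> is
  trivial.\<close>

definition c0_universal ::
  "('b::euclidean_space \<Rightarrow> real) set \<Rightarrow> (('b \<Rightarrow> real) \<Rightarrow> ('b \<Rightarrow> real) \<Rightarrow> real) \<Rightarrow>
   ('b \<Rightarrow> 'b \<Rightarrow> real) \<Rightarrow> bool" where
  "c0_universal H ip K \<longleftrightarrow>
     rkhs H ip K \<and>
     (\<exists>C. \<forall>x y. \<bar>K x y\<bar> \<le> C) \<and>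
     (\<forall>x. continuous_on UNIV (K x) \<and> (K x \<longlongrightarrow> 0) at_infinity) \<and>
     (\<forall>\<mu>. finite_signed_measure borel \<mu> \<longrightarrow> (\<exists>A \<in> sets borel. \<mu> A \<noteq> 0) \<longrightarrow>
        (SUP \<omega>\<in>{\<omega> \<in> H. ip_norm ip \<omega> = 1}. ereal (signed_integral borel \<mu> \<omega>)) > 0)"


section \<open>Regression estimators and the test statistic\<close>

text \<open>An estimator maps a sample size, a data set (a function on \<open>{..<n}\<close>, extensional outside)
  and an evaluation point to a prediction.\<close>

type_synonym 'z estimator = "nat \<Rightarrow> (nat \<Rightarrow> real \<times> 'z) \<Rightarrow> 'z \<Rightarrow> real"

definition regression_estimator :: "'z::topological_space estimator \<Rightarrow> bool" where
  "regression_estimator m \<longleftrightarrow>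
     (\<forall>n. (\<lambda>(D, z). m n D z) \<in> borel_measurable ((\<Pi>\<^sub>M i\<in>{..<n}. borel) \<Otimes>\<^sub>M borel))"

definition fitted ::
  "'z estimator \<Rightarrow> (nat \<Rightarrow> 'a \<Rightarrow> real) \<Rightarrow> (nat \<Rightarrow> 'a \<Rightarrow> 'z) \<Rightarrow> nat \<Rightarrow> nat \<Rightarrow> 'a \<Rightarrow> real" where
  "fitted m U Z n i w = m n (\<lambda>j\<in>{..<n}. (U j w, Z j w)) (Z i w)"

definition residual ::
  "'z estimator \<Rightarrow> (nat \<Rightarrow> 'a \<Rightarrow> real) \<Rightarrow> (nat \<Rightarrow> 'a \<Rightarrow> 'z) \<Rightarrow> nat \<Rightarrow> nat \<Rightarrow> 'a \<Rightarrow> real" where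
  "residual m U Z n i w = U i w - fitted m U Z n i w"

definition mean_sq_error ::
  "('z \<Rightarrow> real) \<Rightarrow> 'z estimator \<Rightarrow> (nat \<Rightarrow> 'a \<Rightarrow> real) \<Rightarrow> (nat \<Rightarrow> 'a \<Rightarrow> 'z) \<Rightarrow> nat \<Rightarrow> 'a \<Rightarrow> real"
  where
  "mean_sq_error h m U Z n w = (1 / real n) * (\<Sum>i<n. (h (Z i w) - fitted m U Z n i w)\<^sup>2)"

definition weighted_stat ::
  "'z estimator \<Rightarrow> 'z estimator \<Rightarrow> (nat \<Rightarrow> 'a \<Rightarrow> real) \<Rightarrow> (nat \<Rightarrow> 'a \<Rightarrow> real) \<Rightarrow>
   (nat \<Rightarrow> 'a \<Rightarrow> 'z) \<Rightarrow> ('z \<Rightarrow> real) \<Rightarrow> nat \<Rightarrow> 'a \<Rightarrow> real" where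
  "weighted_stat fhat ghat X Y Z \<omega> n w =
     (1 / sqrt (real n)) * (\<Sum>i<n. \<omega> (Z i w) * residual fhat X Z n i w * residual ghat Y Z n i w)"

definition sup_stat ::
  "('z \<Rightarrow> real) set \<Rightarrow> (('z \<Rightarrow> real) \<Rightarrow> ('z \<Rightarrow> real) \<Rightarrow> real) \<Rightarrow>
   'z estimator \<Rightarrow> 'z estimator \<Rightarrow> (nat \<Rightarrow> 'a \<Rightarrow> real) \<Rightarrow> (nat \<Rightarrow> 'a \<Rightarrow> real) \<Rightarrow>
   (nat \<Rightarrow> 'a \<Rightarrow> 'z) \<Rightarrow> nat \<Rightarrow> 'a \<Rightarrow> real" where
  "sup_stat H ip fhat ghat X Y Z n w =
     (SUP \<omega>\<in>{\<omega> \<in> H. ip_norm ip \<omega> = 1}. (weighted_stat fhat ghat X Y Z \<omega> n w)\<^sup>2)"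


section \<open>Coordinates of the law\<close>

definition coord_X :: "real \<times> real \<times> 'z \<Rightarrow> real" where "coord_X p = fst p"
definition coord_Y :: "real \<times> real \<times> 'z \<Rightarrow> real" where "coord_Y p = fst (snd p)"
definition coord_Z :: "real \<times> real \<times> 'z \<Rightarrow> 'z" where "coord_Z p = snd (snd p)"

definition eps_X :: "('z \<Rightarrow> real) \<Rightarrow> real \<times> real \<times> 'z \<Rightarrow> real" where
  "eps_X f p = coord_X p - f (coord_Z p)"

definition eps_Y :: "('z \<Rightarrow> real) \<Rightarrow> real \<times> real \<times> 'z \<Rightarrow> real" where
  "eps_Y g p = coord_Y p - g (coord_Z p)"

end

theory Submission
  imports Defs
begin

text \<open>By the reproducing property, \<open>S_n(\<omega>)/sqrt n\<close> is the inner product of \<open>\<omega>\<close> with the weighted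
  kernel mean \<open>V_n = (1/n) \<Sum>_i r_i s_i K(Z_i, -)\<close>, where \<open>r_i\<close>, \<open>s_i\<close> are the residuals, so \<open>\<Psi>_n/n\<close> is
  the squared norm of \<open>V_n\<close>.  Let \<open>m\<close> be the Riesz representer of \<open>\<omega> \<mapsto> E(\<omega>(Z) \<epsilon>_X \<epsilon>_Y)\<close>.  Replacing the
  residuals by the true errors turns \<open>V_n\<close> into an i.i.d. mean, whose mean squared distance to \<open>m\<close> is
  \<open>O(1/n)\<close>, because conditioning on \<open>(Z, Y)\<close> bounds \<open>E(\<epsilon>_X\<^sup>2 \<epsilon>_Y\<^sup>2)\<close>; the replacement costs at most a
  multiple of \<open>sqrt(A_f mean(\<epsilon>_Y\<^sup>2)) + sqrt(A_g mean(\<epsilon>_X\<^sup>2)) + (A_f + A_g)/2\<close>.  Hence \<open>c_star\<close> is the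
  norm of \<open>m\<close>.  If it vanished, every \<open>\<omega>\<close> would integrate to 0 against the signed measure
  \<open>S \<mapsto> E(\<epsilon>_X \<epsilon>_Y; Z \<in> S)\<close>, which universality forbids.\<close>

section \<open>Geometry and measurability in a reproducing kernel Hilbert space\<close>

context rkhs
begin

lemma ip_minus:
  assumes "h \<in> H" "k \<in> H"
  shows "ip (\<lambda>x. h x - k x) (\<lambda>x. h x - k x) = ip h h - 2 * ip h k + ip k k"
  using ip_comb[OF assms, of "-1"] by simp

lemma ip_norm_square: "h \<in> H \<Longrightarrow> (ip_norm ip h)\<^sup>2 = ip h h"
  by (simp add: ip_norm_def ip_nonneg)

lemma ip_norm_nonneg: "h \<in> H \<Longrightarrow> 0 \<le> ip_norm ip h"
  by (simp add: ip_norm_def ip_nonneg)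

text \<open>The one-sided Cauchy-Schwarz inequality is applied to \<open>h\<close> and to
  \<open>-h\<close>, which have equal norms.\<close>

lemma abs_ip_le:
  assumes "h \<in> H" "k \<in> H"
  shows "\<bar>ip h k\<bar> \<le> ip_norm ip h * ip_norm ip k"
proof -
  have m: "(\<lambda>x. (-1) * h x) \<in> H" by (rule scale_in[OF assms(1)])
  have "ip (\<lambda>x. (-1) * h x) (\<lambda>x. (-1) * h x) = ip h h"
    by (simp only: ip_scale_left[OF assms(1) m] ip_scale_right[OF assms(1,1)])
  then have "ip_norm ip (\<lambda>x. (-1) * h x) = ip_norm ip h" by (simp only: ip_norm_def)
  moreover have "ip (\<lambda>x. (-1) * h x) k = - ip h k"
    by (simp only: ip_scale_left[OF assms])
  ultimately show ?thesis
    using Cauchy_Schwarz_ip[OF assms] Cauchy_Schwarz_ip[OF m assms(2)] by simp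
qed

text \<open>With \<open>a = h - k\<close> and \<open>b = k - l\<close>, the cross term of
  \<open>a + b\<close> is absorbed by the nonnegativity of the squared norm of
  \<open>a - b\<close>.\<close>

lemma ip_diff_le_sum:
  assumes "h \<in> H" "k \<in> H" "l \<in> H"
  shows "ip (\<lambda>x. h x - l x) (\<lambda>x. h x - l x)
    \<le> 2 * ip (\<lambda>x. h x - k x) (\<lambda>x. h x - k x) + 2 * ip (\<lambda>x. k x - l x) (\<lambda>x. k x - l x)"
proof -
  define a b where "a = (\<lambda>x. h x - k x)" and "b = (\<lambda>x. k x - l x)"
  have ab: "a \<in> H" "b \<in> H" unfolding a_def b_def using assms by (auto intro: diff_in)
  have "(\<lambda>x. h x - l x) = (\<lambda>x. a x + 1 * b x)" by (simp add: a_def b_def)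
  then have "ip (\<lambda>x. h x - l x) (\<lambda>x. h x - l x) = ip a a + 2 * ip a b + ip b b"
    using ip_comb[OF ab, of 1] by simp
  moreover have "0 \<le> ip a a - 2 * ip a b + ip b b"
    using ip_nonneg[OF diff_in[OF ab]] ip_minus[OF ab] by simp
  ultimately show ?thesis by (simp add: a_def b_def)
qed

text \<open>The representer is obtained as a limit of a minimizing sequence of the quadratic
  functional \<open>J h = ip h h - 2 * L h\<close>. Completeness of \<open>H\<close> provides the
  limit, and the first-order condition along every line through it is the representation.\<close>

lemma riesz_representation:
  assumes add: "\<And>h k. h \<in> H \<Longrightarrow> k \<in> H \<Longrightarrow> L (\<lambda>x. h x + k x) = L h + L k"
    and scale: "\<And>h c. h \<in> H \<Longrightarrow> L (\<lambda>x. c * h x) = c * L h"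
    and bounded: "\<And>h. h \<in> H \<Longrightarrow> \<bar>L h\<bar> \<le> A * ip_norm ip h"
  obtains m where "m \<in> H" "\<And>h. h \<in> H \<Longrightarrow> ip h m = (L h :: real)"
proof -
  define J where "J h = ip h h - 2 * L h" for h
  \<comment> \<open>Completing the square: boundedness of \<open>L\<close> gives
    \<open>J h \<ge> (ip_norm ip h - A)\<^sup>2 - A\<^sup>2\<close>.\<close>
  have J_ge: "- A\<^sup>2 \<le> J h" if "h \<in> H" for h
  proof -
    have "0 \<le> (ip_norm ip h - A)\<^sup>2" by simp
    then show ?thesis
      using bounded[OF that]
      by (simp add: J_def power2_diff ip_norm_square[OF that] mult.assoc mult.commute[of A])
  qed
  define m where "m = (INF h\<in>H. J h)"
  have bdd: "bdd_below (J ` H)" using J_ge by (auto intro!: bdd_belowI2)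
  have m_le: "m \<le> J h" if "h \<in> H" for h unfolding m_def by (rule cINF_lower[OF bdd that])
  have J_line: "J (\<lambda>x. h x + t * k x) = J h + t\<^sup>2 * ip k k + 2 * t * (ip h k - L k)"
    if "h \<in> H" "k \<in> H" for h k t
    using that by (simp add: J_def ip_comb add scale scale_in algebra_simps)
  have "\<exists>h\<in>H. J h < m + 1 / real (Suc n)" for n
    using cINF_less_iff[OF _ bdd, of "m + 1 / real (Suc n)"] zero_in by (auto simp: m_def)
  then obtain s where s: "\<And>n. s n \<in> H" "\<And>n. J (s n) < m + 1 / real (Suc n)" by metis
  \<comment> \<open>The midpoint of \<open>s n\<close> and \<open>s k\<close> cannot have a value
    below the infimum \<open>m\<close>. Eliminating the linear term \<open>ip (s k) d - L d\<close>
    between this bound and the expansion of \<open>J (s n)\<close> leaves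
    \<open>ip d d \<le> 2 * (J (s n) + J (s k) - 2 * m)\<close>.\<close>
  have dist: "(ip_dist (s n) (s k))\<^sup>2 \<le> 2 * (1 / real (Suc n) + 1 / real (Suc k))" for n k
  proof -
    define d where "d = (\<lambda>x. s n x - s k x)"
    have d: "d \<in> H" unfolding d_def by (rule diff_in[OF s(1) s(1)])
    have "s n = (\<lambda>x. s k x + 1 * d x)" by (simp add: d_def)
    then have 1: "J (s n) = J (s k) + ip d d + 2 * (ip (s k) d - L d)"
      using J_line[OF s(1)[of k] d, of 1] by simp
    have "m \<le> J (\<lambda>x. s k x + (1/2) * d x)" by (intro m_le add_in s scale_in d)
    then have "2 * m \<le> 2 * J (s k) + ip d d / 2 + 2 * (ip (s k) d - L d)"
      unfolding J_line[OF s(1)[of k] d] by (simp add: power2_eq_square)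
    moreover have "(ip_dist (s n) (s k))\<^sup>2 = ip d d"
      by (simp add: ip_dist_def s flip: d_def) (simp add: ip_norm_square d)
    ultimately show ?thesis using 1 s(2)[of n] s(2)[of k] by argo
  qed
  have "MCauchy s"
    unfolding MCauchy_def
  proof (intro conjI allI impI)
    fix e :: real assume e: "e > 0"
    obtain N where N: "1 / real (Suc N) < e\<^sup>2 / 4"
      using nat_approx_posE[of "e\<^sup>2 / 4"] e by auto
    show "\<exists>N. \<forall>n n'. N \<le> n \<longrightarrow> N \<le> n' \<longrightarrow> ip_dist (s n) (s n') < e"
    proof (intro exI allI impI)
      fix n k assume nk: "N \<le> n" "N \<le> k"
      have "1 / real (Suc n) \<le> 1 / real (Suc N)" "1 / real (Suc k) \<le> 1 / real (Suc N)"
        using nk by (auto intro!: divide_left_mono)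
      then have "(ip_dist (s n) (s k))\<^sup>2 < e\<^sup>2" using dist[of n k] N by argo
      then show "ip_dist (s n) (s k) < e" using e by (simp add: power_less_imp_less_base)
    qed
  qed (use s in auto)
  then obtain u where "limitin mtopology s u sequentially"
    using complete unfolding mcomplete_def by blast
  then have u: "u \<in> H" "\<And>e. e > 0 \<Longrightarrow> \<exists>N. \<forall>n\<ge>N. ip_dist (s n) u < e"
    unfolding limit_metric_sequentially by blast+
  show ?thesis
  proof
    show "u \<in> H" by (rule u)
    fix k assume k: "k \<in> H"
    have lim0: "(\<lambda>n. ip_dist (s n) u) \<longlonglongrightarrow> 0"
      using u(2) by (auto simp: lim_sequentially dist_real_def abs_if) (metis nonneg not_less)
    have lim: "(\<lambda>n. ip (s n) k) \<longlonglongrightarrow> ip u k"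
    proof (rule Lim_transform2[OF tendsto_const[of "ip u k"]])
      show "(\<lambda>n. ip u k - ip (s n) k) \<longlonglongrightarrow> 0"
      proof (rule Lim_null_comparison)
        have "(\<lambda>n. ip_dist (s n) u * ip_norm ip k) \<longlonglongrightarrow> 0 * ip_norm ip k"
          by (intro tendsto_intros lim0)
        then show "(\<lambda>n. ip_dist (s n) u * ip_norm ip k) \<longlonglongrightarrow> 0" by simp
        have "norm (ip u k - ip (s n) k) \<le> ip_dist (s n) u * ip_norm ip k" for n
        proof -
          have d: "(\<lambda>x. s n x - u x) \<in> H" by (rule diff_in[OF s(1) u(1)])
          have "ip (s n) k = ip (\<lambda>x. (s n x - u x) + u x) k" by simp
          also have "\<dots> = ip (\<lambda>x. s n x - u x) k + ip u k" by (rule ip_add_left[OF d u(1) k])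
          finally show ?thesis using abs_ip_le[OF d k] by (simp add: ip_dist_def s u)
        qed
        then show "\<forall>\<^sub>F n in sequentially. norm (ip u k - ip (s n) k) \<le> ip_dist (s n) u * ip_norm ip k"
          by simp
      qed
    qed
    \<comment> \<open>The inequality is proved along the minimizing sequence with error
      \<open>1 / real (Suc n)\<close> and then passed to the limit, so \<open>J u\<close> itself is
      never evaluated.\<close>
    have nonneg_line: "0 \<le> t\<^sup>2 * ip k k + 2 * t * (ip u k - L k)" for t
    proof (rule LIMSEQ_le)
      show "(\<lambda>n. - (1 / real (Suc n))) \<longlonglongrightarrow> 0"
        using tendsto_minus[OF LIMSEQ_inverse_real_of_nat] by (simp add: inverse_eq_divide)
      show "(\<lambda>n. t\<^sup>2 * ip k k + 2 * t * (ip (s n) k - L k))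
          \<longlonglongrightarrow> t\<^sup>2 * ip k k + 2 * t * (ip u k - L k)"
        by (intro tendsto_intros lim)
      have "- (1 / real (Suc n)) \<le> t\<^sup>2 * ip k k + 2 * t * (ip (s n) k - L k)" for n
        using m_le[OF add_in[OF s(1)[of n] scale_in[OF k, of t]]] s(2)[of n]
        by (simp add: J_line s k)
      then show "\<exists>N. \<forall>n\<ge>N. - (1 / real (Suc n)) \<le> t\<^sup>2 * ip k k + 2 * t * (ip (s n) k - L k)"
        by blast
    qed
    define b where "b = ip u k - L k"
    \<comment> \<open>Adding 1 keeps the denominator positive even for \<open>k = 0\<close>; the
      choice \<open>t = - b / q\<close> nearly minimizes the quadratic and forces
      \<open>b = 0\<close>.\<close>
    define q where "q = ip k k + 1"
    have q: "q > 0" using ip_nonneg[OF k] by (simp add: q_def)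
    have "0 \<le> (- b / q)\<^sup>2 * ip k k + 2 * (- b / q) * b"
      using nonneg_line[of "- b / q"] by (simp add: b_def)
    also have "\<dots> \<le> (- b / q)\<^sup>2 * q + 2 * (- b / q) * b"
      by (simp add: q_def mult_left_mono)
    also have "\<dots> = - (b\<^sup>2 / q)" using q by (simp add: field_simps power2_eq_square)
    finally have "b\<^sup>2 \<le> 0" using q by (simp add: field_simps)
    then show "ip k u = L k" by (simp add: b_def ip_commute[OF k u(1)])
  qed
qed

section \<open>Finite linear combinations of kernel sections\<close>

definition kernel_comb :: "nat \<Rightarrow> (nat \<Rightarrow> real) \<Rightarrow> (nat \<Rightarrow> 'b) \<Rightarrow> 'b \<Rightarrow> real" where
  "kernel_comb n a x y = (\<Sum>i<n. a i * K (x i) y)"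

lemma kernel_comb_Suc:
  "kernel_comb (Suc n) a x = (\<lambda>y. kernel_comb n a x y + a n * K (x n) y)"
  by (simp add: kernel_comb_def fun_eq_iff)

lemma kernel_comb_in: "kernel_comb n a x \<in> H"
proof (induction n)
  case 0
  show ?case using zero_in by (simp add: kernel_comb_def[abs_def])
next
  case (Suc n)
  then show ?case unfolding kernel_comb_Suc by (intro add_in scale_in kernel_in)
qed

lemma ip_kernel_comb: "h \<in> H \<Longrightarrow> ip h (kernel_comb n a x) = (\<Sum>i<n. a i * h (x i))"
proof (induction n)
  case 0
  show ?case using ip_scale_right[OF zero_in 0, of 0] by (simp add: kernel_comb_def[abs_def])
next
  case (Suc n)
  then show ?case unfolding kernel_comb_Suc
    by (simp add: ip_add_right kernel_comb_in scale_in kernel_in ip_scale_right reproducing)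
qed

lemma ip_kernel_comb_self:
  "ip (kernel_comb n a x) (kernel_comb n a x) = (\<Sum>i<n. \<Sum>j<n. a i * a j * K (x i) (x j))"
proof -
  have "ip (kernel_comb n a x) (kernel_comb n a x)
      = (\<Sum>i<n. \<Sum>j<n. a i * (a j * K (x j) (x i)))"
    by (simp add: ip_kernel_comb kernel_comb_in) (simp add: kernel_comb_def sum_distrib_left)
  then show ?thesis by (subst (asm) sum.swap) (simp add: ac_simps)
qed

lemma kernel_comb_diff:
  "(\<lambda>y. kernel_comb n a x y - kernel_comb n b x y) = kernel_comb n (\<lambda>i. a i - b i) x"
  by (simp add: kernel_comb_def fun_eq_iff sum_subtractf left_diff_distrib)

text \<open>Expanding the square and bounding each kernel value by \<open>C\<close> leaves a product
  of two equal sums. This controls a perturbation of the coefficients by its absolute sum alone,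
  wherever the points lie.\<close>

lemma ip_kernel_comb_le:
  assumes C: "\<And>x y. \<bar>K x y\<bar> \<le> C"
  shows "ip (kernel_comb n a x) (kernel_comb n a x) \<le> C * (\<Sum>i<n. \<bar>a i\<bar>)\<^sup>2"
proof -
  have "ip (kernel_comb n a x) (kernel_comb n a x) \<le> (\<Sum>i<n. \<Sum>j<n. \<bar>a i\<bar> * \<bar>a j\<bar> * C)"
    unfolding ip_kernel_comb_self
  proof (intro sum_mono)
    fix i j
    have "a i * a j * K (x i) (x j) \<le> \<bar>a i * a j\<bar> * \<bar>K (x i) (x j)\<bar>"
      by (metis abs_ge_self abs_mult)
    also have "\<dots> \<le> \<bar>a i * a j\<bar> * C" by (intro mult_left_mono C) simp
    finally show "a i * a j * K (x i) (x j) \<le> \<bar>a i\<bar> * \<bar>a j\<bar> * C" by (simp add: abs_mult)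
  qed
  then show ?thesis
    by (simp add: power2_eq_square sum_product sum_distrib_left ac_simps)
qed

text \<open>Evaluation at \<open>x\<close> is the inner product with \<open>K x\<close>, whose
  squared norm is \<open>K x x \<le> C\<close>. Hence every element of \<open>H\<close> is a bounded
  function.\<close>

lemma abs_eval_le:
  assumes C: "\<And>x y. \<bar>K x y\<bar> \<le> C" and h: "h \<in> H"
  shows "\<bar>h x\<bar> \<le> sqrt C * ip_norm ip h"
proof -
  have "\<bar>h x\<bar> \<le> ip_norm ip h * ip_norm ip (K x)"
    using abs_ip_le[OF h kernel_in[of x]] by (simp add: reproducing h)
  also have "ip_norm ip (K x) \<le> sqrt C"
    using C[of x x] by (simp add: ip_norm_def reproducing kernel_in)
  finally show ?thesis using ip_norm_nonneg[OF h] by (simp add: mult.commute[of "sqrt C"] mult_left_mono)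
qed

section \<open>Suprema over the unit sphere\<close>

lemma normalize_in_sphere:
  assumes "h \<in> H" "ip h h \<noteq> 0"
  shows "(\<lambda>x. (1 / ip_norm ip h) * h x) \<in> H"
    and "ip_norm ip (\<lambda>x. (1 / ip_norm ip h) * h x) = 1"
proof -
  define r where "r = ip_norm ip h"
  have r: "r > 0" using assms ip_nonneg[OF assms(1)] by (simp add: r_def ip_norm_def)
  show s: "(\<lambda>x. (1 / ip_norm ip h) * h x) \<in> H" by (rule scale_in[OF assms(1)])
  have "ip (\<lambda>x. (1 / r) * h x) (\<lambda>x. (1 / r) * h x) = (1 / r) * ((1 / r) * ip h h)"
    using ip_scale_left[OF assms(1) s, of "1/r"] ip_scale_right[OF assms(1,1), of "1/r"]
    by (simp add: r_def)
  also have "ip h h = r\<^sup>2" using assms by (simp add: r_def ip_norm_square)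
  also have "(1 / r) * ((1 / r) * r\<^sup>2) = 1" using r by (simp add: power2_eq_square)
  finally show "ip_norm ip (\<lambda>x. (1 / ip_norm ip h) * h x) = 1"
    by (simp only: ip_norm_def[of ip "\<lambda>x. (1 / r) * h x"] real_sqrt_one flip: r_def)
qed

text \<open>Cauchy-Schwarz gives the upper bound, and it is attained at \<open>v\<close> divided by
  its norm, or at any unit vector when \<open>v\<close> has norm 0. The factor \<open>a\<close> will
  be the sample size.\<close>

lemma SUP_sphere_ip:
  assumes v: "v \<in> H" and ne: "{\<omega> \<in> H. ip_norm ip \<omega> = 1} \<noteq> {}" and a: "a \<ge> 0"
  shows "(SUP \<omega>\<in>{\<omega> \<in> H. ip_norm ip \<omega> = 1}. a * (ip \<omega> v)\<^sup>2) = a * ip v v"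
proof (rule cSup_eq_maximum)
  show "x \<le> a * ip v v" if x: "x \<in> (\<lambda>\<omega>. a * (ip \<omega> v)\<^sup>2) ` {\<omega> \<in> H. ip_norm ip \<omega> = 1}" for x
  proof -
    from x obtain \<omega> where \<omega>: "\<omega> \<in> H" "ip_norm ip \<omega> = 1" "x = a * (ip \<omega> v)\<^sup>2" by auto
    have "\<bar>ip \<omega> v\<bar> \<le> ip_norm ip v" using abs_ip_le[OF \<omega>(1) v] \<omega>(2) by simp
    then have "(ip \<omega> v)\<^sup>2 \<le> ip v v"
      using abs_le_square_iff[of "ip \<omega> v" "ip_norm ip v"] ip_norm_nonneg[OF v] ip_norm_square[OF v]
      by simp
    then show ?thesis using a \<omega>(3) by (simp add: mult_left_mono)
  qed
  show "a * ip v v \<in> (\<lambda>\<omega>. a * (ip \<omega> v)\<^sup>2) ` {\<omega> \<in> H. ip_norm ip \<omega> = 1}"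
  proof (cases "ip v v = 0")
    case True
    from ne obtain \<omega> where \<omega>: "\<omega> \<in> H" "ip_norm ip \<omega> = 1" by auto
    have "ip_norm ip v = 0" using True by (simp add: ip_norm_def)
    then have "ip \<omega> v = 0" using abs_ip_le[OF \<omega>(1) v] by simp
    then show ?thesis using \<omega> True by (intro image_eqI[of _ _ \<omega>]) auto
  next
    case False
    then have p: "ip v v > 0" using ip_nonneg[OF v] by simp
    have "ip (\<lambda>x. (1 / ip_norm ip v) * v x) v = ip v v / ip_norm ip v"
      using ip_scale_left[OF v v, of "1 / ip_norm ip v"] by simp
    then have "(ip (\<lambda>x. (1 / ip_norm ip v) * v x) v)\<^sup>2 = ip v v"
      using p by (simp only: power_divide ip_norm_square[OF v]) (simp add: power2_eq_square)
    then show ?thesis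
      using normalize_in_sphere[OF v False]
      by (intro image_eqI[of _ _ "\<lambda>x. (1 / ip_norm ip v) * v x"]) auto
  qed
qed

end

section \<open>Measurability of norms and of the kernel from separability\<close>

context separable_rkhs
begin

lemma countable_dense:
  "\<exists>D\<subseteq>H. countable D \<and> (\<forall>h\<in>H. \<forall>e>0. \<exists>d\<in>D. ip (\<lambda>x. h x - d x) (\<lambda>x. h x - d x) < e)"
proof -
  obtain D where D: "countable D" "D \<subseteq> H" "mtopology closure_of D = H"
    using separable by (auto simp: separable_space_def)
  have "\<exists>d\<in>D. ip (\<lambda>x. h x - d x) (\<lambda>x. h x - d x) < e" if "h \<in> H" "e > 0" for h e
  proof -
    have "h \<in> mtopology closure_of D" using D(3) that by simp
    then obtain d where d: "d \<in> D" "ip_dist h d < sqrt e"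
      using \<open>e > 0\<close> unfolding metric_closure_of by (auto simp: in_mball) (metis real_sqrt_gt_0_iff)
    then have "sqrt (ip (\<lambda>x. h x - d x) (\<lambda>x. h x - d x)) < sqrt e"
      using D(2) that by (auto simp: ip_dist_def ip_norm_def)
    then show ?thesis using d(1) by auto
  qed
  then show ?thesis using D(1,2) by blast
qed

text \<open>Since \<open>ip v v - ip (v - d) (v - d) = 2 * ip d v - ip d d\<close>, the squared norm is a supremum
  over a countable dense set.\<close>

lemma borel_measurable_ip_self:
  assumes v: "\<And>w. w \<in> space M \<Longrightarrow> v w \<in> H"
    and weak: "\<And>d. d \<in> H \<Longrightarrow> (\<lambda>w. ip d (v w)) \<in> borel_measurable M"
  shows "(\<lambda>w. ip (v w) (v w)) \<in> borel_measurable M"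
proof -
  obtain D where D: "countable D" "D \<subseteq> H"
    and dense: "\<And>h e. h \<in> H \<Longrightarrow> e > 0 \<Longrightarrow> \<exists>d\<in>D. ip (\<lambda>x. h x - d x) (\<lambda>x. h x - d x) < e"
    using countable_dense by blast
  have D_ne: "D \<noteq> {}" using dense[OF zero_in, of 1] by auto
  have eq: "2 * ip d h - ip d d = ip h h - ip (\<lambda>x. h x - d x) (\<lambda>x. h x - d x)"
    if "d \<in> H" "h \<in> H" for d h
    using ip_minus[OF that(2,1)] ip_commute[OF that] by simp
  have le: "2 * ip d h - ip d d \<le> ip h h" if "d \<in> H" "h \<in> H" for d h
    using eq[OF that] ip_nonneg[OF diff_in[OF that(2,1)]] by simp
  have bdd: "bdd_above ((\<lambda>d. 2 * ip d h - ip d d) ` D)" if "h \<in> H" for h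
    using le D(2) that by (intro bdd_aboveI2[of _ _ "ip h h"]) auto
  have sup: "ip h h = (SUP d\<in>D. 2 * ip d h - ip d d)" if h: "h \<in> H" for h
  proof (rule antisym)
    show "(SUP d\<in>D. 2 * ip d h - ip d d) \<le> ip h h"
      using le D h D_ne by (intro cSUP_least) auto
    show "ip h h \<le> (SUP d\<in>D. 2 * ip d h - ip d d)"
    proof (rule field_le_epsilon)
      fix e :: real assume "e > 0"
      then obtain d where d: "d \<in> D" "ip (\<lambda>x. h x - d x) (\<lambda>x. h x - d x) < e"
        using dense[OF h] by blast
      then show "ip h h \<le> (SUP d\<in>D. 2 * ip d h - ip d d) + e"
        using cSUP_upper[OF d(1) bdd[OF h]] eq[of d h] D(2) h by fastforce
    qed
  qed
  have "(\<lambda>w. SUP d\<in>D. 2 * ip d (v w) - ip d d) \<in> borel_measurable M"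
    using D weak by (intro borel_measurable_cSUP) (auto intro!: bdd v borel_measurable_diff borel_measurable_times)
  then show ?thesis using v by (subst measurable_cong[OF sup]) auto
qed

text \<open>Polarization writes \<open>4 * K x y\<close> as the squared norm of
  \<open>K x + K y\<close> minus that of \<open>K x - K y\<close>. Testing these vectors against
  \<open>d\<close> gives \<open>d x + d y\<close> and \<open>d x - d y\<close>, so measurability of
  the single functions in \<open>H\<close> yields joint measurability of the kernel.\<close>

lemma borel_measurable_kernel:
  assumes H: "\<And>h. h \<in> H \<Longrightarrow> h \<in> borel_measurable N"
    and x: "x \<in> measurable M N" and y: "y \<in> measurable M N"
  shows "(\<lambda>w. K (x w) (y w)) \<in> borel_measurable M"
proof -
  have Hx: "(\<lambda>w. h (x w)) \<in> borel_measurable M" "(\<lambda>w. h (y w)) \<in> borel_measurable M"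
    if "h \<in> H" for h
    using measurable_compose[OF x H[OF that]] measurable_compose[OF y H[OF that]] by auto
  have m: "(\<lambda>w. ip (\<lambda>t. K (x w) t + c * K (y w) t) (\<lambda>t. K (x w) t + c * K (y w) t)) \<in> borel_measurable M" for c
  proof (rule borel_measurable_ip_self)
    show "(\<lambda>t. K (x w) t + c * K (y w) t) \<in> H" for w by (intro add_in scale_in kernel_in)
    fix d assume d: "d \<in> H"
    show "(\<lambda>w. ip d (\<lambda>t. K (x w) t + c * K (y w) t)) \<in> borel_measurable M"
      using Hx[OF d] d
      by (simp add: ip_add_right scale_in kernel_in ip_scale_right reproducing)
  qed
  have "K (x w) (y w) = (ip (\<lambda>t. K (x w) t + 1 * K (y w) t) (\<lambda>t. K (x w) t + 1 * K (y w) t)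
      - ip (\<lambda>t. K (x w) t + (-1) * K (y w) t) (\<lambda>t. K (x w) t + (-1) * K (y w) t)) / 4" for w
    unfolding ip_comb[OF kernel_in kernel_in] by (simp add: reproducing kernel_in)
  then show ?thesis using m[of 1] m[of "-1"] by (simp only:) (intro borel_measurable_divide borel_measurable_diff borel_measurable_const)
qed

end

section \<open>Convergence in probability\<close>

lemma converges_in_probD:
  assumes "converges_in_prob M U c"
  shows "U n \<in> borel_measurable M"
    and "e > 0 \<Longrightarrow> (\<lambda>n. measure M {w \<in> space M. \<bar>U n w - c\<bar> > e}) \<longlonglongrightarrow> 0"
  using assms by (auto simp: converges_in_prob_def)

text \<open>Deviations of \<open>U\<close> are contained in deviations of \<open>V\<close>.
  Measurability of \<open>U\<close> is a separate premise because domination does not provide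
  it.\<close>

lemma converges_in_prob_dominated:
  assumes "finite_measure M" and V: "converges_in_prob M V 0"
    and U: "\<And>n. U n \<in> borel_measurable M"
    and le: "\<And>n w. w \<in> space M \<Longrightarrow> \<bar>U n w - c\<bar> \<le> V n w"
  shows "converges_in_prob M U c"
  unfolding converges_in_prob_def
proof (intro conjI allI impI U)
  interpret finite_measure M by fact
  note [measurable] = U
  have [measurable]: "V n \<in> borel_measurable M" for n
    using V by (simp add: converges_in_prob_def)
  fix e :: real assume "e > 0"
  then have lim: "(\<lambda>n. measure M {w \<in> space M. \<bar>V n w - 0\<bar> > e}) \<longlonglongrightarrow> 0"
    by (rule converges_in_probD[OF V])
  show "(\<lambda>n. measure M {w \<in> space M. \<bar>U n w - c\<bar> > e}) \<longlonglongrightarrow> 0"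
  proof (rule tendsto_sandwich[OF _ _ tendsto_const lim])
    show "\<forall>\<^sub>F n in sequentially. measure M {w \<in> space M. \<bar>U n w - c\<bar> > e}
        \<le> measure M {w \<in> space M. \<bar>V n w - 0\<bar> > e}"
    proof (intro always_eventually allI finite_measure_mono subsetI)
      fix n w assume "w \<in> {w \<in> space M. \<bar>U n w - c\<bar> > e}"
      then show "w \<in> {w \<in> space M. \<bar>V n w - 0\<bar> > e}" using le[of w n] by auto
    qed measurable
  qed auto
qed

lemma converges_in_prob_add:
  assumes "finite_measure M" and UV: "converges_in_prob M U c" "converges_in_prob M V d"
  shows "converges_in_prob M (\<lambda>n w. U n w + V n w) (c + d)"
  unfolding converges_in_prob_def
proof (intro conjI allI impI)
  interpret finite_measure M by fact
  have [measurable]: "U n \<in> borel_measurable M" "V n \<in> borel_measurable M" for n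
    using UV by (auto simp: converges_in_prob_def)
  show "(\<lambda>w. U n w + V n w) \<in> borel_measurable M" for n by measurable
  fix e :: real assume e: "e > 0"
  have "(\<lambda>n. measure M {w \<in> space M. \<bar>U n w - c\<bar> > e / 2}
      + measure M {w \<in> space M. \<bar>V n w - d\<bar> > e / 2}) \<longlonglongrightarrow> 0 + 0"
    using e by (intro tendsto_add converges_in_probD[OF UV(1)] converges_in_probD[OF UV(2)]) auto
  then have lim: "(\<lambda>n. measure M {w \<in> space M. \<bar>U n w - c\<bar> > e / 2}
      + measure M {w \<in> space M. \<bar>V n w - d\<bar> > e / 2}) \<longlonglongrightarrow> 0" by simp
  show "(\<lambda>n. measure M {w \<in> space M. \<bar>U n w + V n w - (c + d)\<bar> > e}) \<longlonglongrightarrow> 0"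
  proof (rule tendsto_sandwich[OF _ _ tendsto_const lim])
    show "\<forall>\<^sub>F n in sequentially. measure M {w \<in> space M. \<bar>U n w + V n w - (c + d)\<bar> > e}
        \<le> measure M {w \<in> space M. \<bar>U n w - c\<bar> > e / 2}
          + measure M {w \<in> space M. \<bar>V n w - d\<bar> > e / 2}"
    proof (intro always_eventually allI)
      fix n
      have "\<bar>x - c\<bar> > e / 2 \<or> \<bar>y - d\<bar> > e / 2" if "\<bar>x + y - (c + d)\<bar> > e" for x y
        using that by argo
      then have "measure M {w \<in> space M. \<bar>U n w + V n w - (c + d)\<bar> > e}
        \<le> measure M ({w \<in> space M. \<bar>U n w - c\<bar> > e / 2} \<union> {w \<in> space M. \<bar>V n w - d\<bar> > e / 2})"
        by (intro finite_measure_mono subsetI) (blast, measurable)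
      also have "\<dots> \<le> measure M {w \<in> space M. \<bar>U n w - c\<bar> > e / 2}
          + measure M {w \<in> space M. \<bar>V n w - d\<bar> > e / 2}"
        by (intro measure_Un_le) measurable
      finally show "measure M {w \<in> space M. \<bar>U n w + V n w - (c + d)\<bar> > e}
        \<le> measure M {w \<in> space M. \<bar>U n w - c\<bar> > e / 2}
          + measure M {w \<in> space M. \<bar>V n w - d\<bar> > e / 2}" .
    qed
  qed auto
qed

text \<open>The continuous mapping theorem for a constant limit, where continuity at that one point
  suffices.\<close>

lemma converges_in_prob_isCont:
  fixes \<phi> :: "real \<Rightarrow> real"
  assumes "finite_measure M" and U: "converges_in_prob M U c"
    and \<phi>: "\<phi> \<in> borel_measurable borel" "isCont \<phi> c"
  shows "converges_in_prob M (\<lambda>n w. \<phi> (U n w)) (\<phi> c)"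
  unfolding converges_in_prob_def
proof (intro conjI allI impI)
  interpret finite_measure M by fact
  note [measurable] = \<phi>(1)
  have [measurable]: "U n \<in> borel_measurable M" for n
    using U by (simp add: converges_in_prob_def)
  show "(\<lambda>w. \<phi> (U n w)) \<in> borel_measurable M" for n by measurable
  fix e :: real assume "e > 0"
  then obtain d where d: "d > 0" "\<And>x. \<bar>x - c\<bar> < d \<Longrightarrow> \<bar>\<phi> x - \<phi> c\<bar> < e"
    using \<phi>(2) unfolding continuous_at_eps_delta by (auto simp: dist_real_def)
  \<comment> \<open>Outside the \<open>d\<close>-ball only the weak inequality
    \<open>\<bar>x - c\<bar> \<ge> d\<close> is known; halving \<open>d\<close> makes it strict, as
    the definition of convergence requires.\<close>
  have lim: "(\<lambda>n. measure M {w \<in> space M. \<bar>U n w - c\<bar> > d / 2}) \<longlonglongrightarrow> 0"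
    using d(1) by (intro converges_in_probD[OF U]) simp
  show "(\<lambda>n. measure M {w \<in> space M. \<bar>\<phi> (U n w) - \<phi> c\<bar> > e}) \<longlonglongrightarrow> 0"
  proof (rule tendsto_sandwich[OF _ _ tendsto_const lim])
    have "\<bar>x - c\<bar> > d / 2" if "\<bar>\<phi> x - \<phi> c\<bar> > e" for x
      using d(1) d(2)[of x] that by linarith
    then show "\<forall>\<^sub>F n in sequentially. measure M {w \<in> space M. \<bar>\<phi> (U n w) - \<phi> c\<bar> > e}
        \<le> measure M {w \<in> space M. \<bar>U n w - c\<bar> > d / 2}"
      by (intro always_eventually allI finite_measure_mono) auto
  qed auto
qed

text \<open>Markov's inequality bounds the probability of exceeding \<open>e\<close> by the mean
  divided by \<open>e\<close>.\<close>

lemma converges_in_prob_if_mean_tendsto_0: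
  assumes "finite_measure M" and U: "\<And>n. integrable M (U n)"
    and nonneg: "\<And>n w. w \<in> space M \<Longrightarrow> 0 \<le> U n w"
    and lim: "(\<lambda>n. \<integral>w. U n w \<partial>M) \<longlonglongrightarrow> 0"
  shows "converges_in_prob M U 0"
  unfolding converges_in_prob_def
proof (intro conjI allI impI)
  interpret finite_measure M by fact
  note [measurable] = borel_measurable_integrable[OF U]
  show "U n \<in> borel_measurable M" for n by measurable
  fix e :: real assume e: "e > 0"
  have lim': "(\<lambda>n. (\<integral>w. U n w \<partial>M) / e) \<longlonglongrightarrow> 0" using tendsto_divide[OF lim tendsto_const] e by auto
  show "(\<lambda>n. measure M {w \<in> space M. \<bar>U n w - 0\<bar> > e}) \<longlonglongrightarrow> 0"
  proof (rule tendsto_sandwich[OF _ _ tendsto_const lim'])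
    have "measure M {w \<in> space M. \<bar>U n w - 0\<bar> > e} \<le> (\<integral>w. U n w \<partial>M) / e" for n
    proof -
      have "measure M {w \<in> space M. \<bar>U n w - 0\<bar> > e} \<le> measure M {w \<in> space M. U n w \<ge> e}"
        using nonneg[of _ n] by (intro finite_measure_mono subsetI) auto
      also have "\<dots> \<le> (\<integral>w. U n w \<partial>M) / e"
        using nonneg e by (intro integral_Markov_inequality_measure[OF U, of "{}"]) auto
      finally show ?thesis .
    qed
    then show "\<forall>\<^sub>F n in sequentially. measure M {w \<in> space M. \<bar>U n w - 0\<bar> > e}
        \<le> (\<integral>w. U n w \<partial>M) / e" by simp
  qed auto
qed

text \<open>Bounded means make \<open>V\<close> tight by Markov's inequality, and a null sequence
  times a tight one is null: a product above \<open>e\<close> forces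
  \<open>\<bar>U n w\<bar> > e / k\<close> or \<open>V n w \<ge> k\<close>.\<close>

lemma converges_in_prob_mult_bounded_mean:
  assumes "finite_measure M" and U: "converges_in_prob M U 0"
    and V: "\<And>n. integrable M (V n)" "\<And>n w. w \<in> space M \<Longrightarrow> 0 \<le> V n w"
      "\<And>n. (\<integral>w. V n w \<partial>M) \<le> b"
  shows "converges_in_prob M (\<lambda>n w. U n w * V n w) 0"
  unfolding converges_in_prob_def
proof (intro conjI allI impI)
  interpret finite_measure M by fact
  have [measurable]: "U n \<in> borel_measurable M" for n
    using U by (simp add: converges_in_prob_def)
  note [measurable] = borel_measurable_integrable[OF V(1)]
  show "(\<lambda>w. U n w * V n w) \<in> borel_measurable M" for n by measurable
  fix e :: real assume e: "e > 0"
  have bound: "measure M {w \<in> space M. \<bar>U n w * V n w - 0\<bar> > e}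
      \<le> measure M {w \<in> space M. \<bar>U n w\<bar> > e / k} + b / k" if k: "k > 0" for n k
  proof -
    have "\<bar>U n w\<bar> > e / k \<or> V n w \<ge> k" if "\<bar>U n w * V n w\<bar> > e" "w \<in> space M" for w
    proof (rule ccontr)
      assume "\<not> (\<bar>U n w\<bar> > e / k \<or> V n w \<ge> k)"
      then have "\<bar>U n w\<bar> * V n w \<le> (e / k) * k"
        using V(2)[OF that(2), of n] e k by (intro mult_mono) auto
      then show False using that V(2)[OF that(2), of n] k by (simp add: abs_mult)
    qed
    then have "measure M {w \<in> space M. \<bar>U n w * V n w - 0\<bar> > e}
        \<le> measure M ({w \<in> space M. \<bar>U n w\<bar> > e / k} \<union> {w \<in> space M. V n w \<ge> k})"
      by (intro finite_measure_mono) auto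
    also have "\<dots> \<le> measure M {w \<in> space M. \<bar>U n w\<bar> > e / k} + measure M {w \<in> space M. V n w \<ge> k}"
      by (intro measure_Un_le) measurable
    also have "measure M {w \<in> space M. V n w \<ge> k} \<le> (\<integral>w. V n w \<partial>M) / k"
      using V(2) k by (intro integral_Markov_inequality_measure[OF V(1), of "{}"]) auto
    also have "\<dots> \<le> b / k" using V(3) k by (simp add: divide_right_mono)
    finally show ?thesis by simp
  qed
  show "(\<lambda>n. measure M {w \<in> space M. \<bar>U n w * V n w - 0\<bar> > e}) \<longlonglongrightarrow> 0"
  proof (rule LIMSEQ_I)
    fix r :: real assume r: "r > 0"
    \<comment> \<open>The truncation level makes the tail bound \<open>b / k\<close> smaller than
      \<open>r / 2\<close>; using \<open>\<bar>b\<bar> + 1\<close> keeps it positive whatever the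
      value of \<open>b\<close>.\<close>
    define k where "k = 2 * (\<bar>b\<bar> + 1) / r"
    have k: "k > 0" using r by (simp add: k_def)
    have bk: "b / k < r / 2"
    proof -
      have "b < \<bar>b\<bar> + 1" by simp
      then have "b / k < (\<bar>b\<bar> + 1) / k" using k by (simp add: divide_strict_right_mono)
      also have "\<dots> = r / 2" by (simp add: k_def field_simps)
      finally show ?thesis by simp
    qed
    have lim: "(\<lambda>n. measure M {w \<in> space M. \<bar>U n w - 0\<bar> > e / k}) \<longlonglongrightarrow> 0"
      using e k by (intro converges_in_probD[OF U]) simp
    obtain N where N: "\<forall>n\<ge>N. norm (measure M {w \<in> space M. \<bar>U n w - 0\<bar> > e / k} - 0) < r / 2"
      using LIMSEQ_D[OF lim half_gt_zero[OF r]] by blast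
    have "norm (measure M {w \<in> space M. \<bar>U n w * V n w - 0\<bar> > e} - 0) < r" if "n \<ge> N" for n
      using N[rule_format, OF that] bound[OF k, of n] bk
      unfolding diff_zero real_norm_def abs_of_nonneg[OF measure_nonneg] by argo
    then show "\<exists>N. \<forall>n\<ge>N. norm (measure M {w \<in> space M. \<bar>U n w * V n w - 0\<bar> > e} - 0) < r"
      by blast
  qed
qed

text \<open>Serves the degenerate case of an empty unit sphere, where the statistic does not depend
  on the data.\<close>

lemma converges_in_prob_const:
  assumes "finite_measure M" "(s \<longlonglongrightarrow> 0)"
  shows "converges_in_prob M (\<lambda>n w. s n) 0"
proof -
  interpret finite_measure M by fact
  have "(\<lambda>n. \<integral>w. \<bar>s n\<bar> \<partial>M) \<longlonglongrightarrow> 0"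
    using tendsto_mult_right_zero[OF tendsto_rabs_zero[OF assms(2)]] by simp
  then have "converges_in_prob M (\<lambda>n w. \<bar>s n\<bar>) 0"
    by (intro converges_in_prob_if_mean_tendsto_0[OF assms(1)]) auto
  then show ?thesis by (rule converges_in_prob_dominated[OF assms(1)]) auto
qed

section \<open>Conditional moments\<close>

lemma subalgebra_sigma_gen:
  assumes "V \<in> borel_measurable P"
  shows "subalgebra P (sigma_gen P V)"
  using measurable_space[OF assms] assms
  by (auto simp: subalgebra_def sets_vimage_algebra2 measurable_sets)

lemma sigma_finite_subalgebra_sigma_gen:
  assumes "prob_space P" "V \<in> borel_measurable P"
  shows "sigma_finite_subalgebra P (sigma_gen P V)"
proof -
  interpret prob_space P by fact
  show ?thesis
    by (intro finite_measure_subalgebra_is_sigma_finite finite_measure_subalgebra.intro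
      finite_measure_subalgebra_axioms.intro subalgebra_sigma_gen assms finite_measure_axioms)
qed

text \<open>The factor \<open>\<phi> (V w)\<close> is measurable for the conditioning sigma-algebra,
  so \<open>W\<close> may be replaced by its conditional expectation, which is at most
  \<open>B\<close> almost everywhere. With \<open>\<phi> = 1\<close> this bounds a plain moment;
  with a squared error it bounds a mixed moment.\<close>

lemma nn_integral_le_if_nn_cond_exp_le:
  fixes \<phi> :: "'b::topological_space \<Rightarrow> ennreal"
  assumes P: "prob_space P" and V: "V \<in> borel_measurable P" and W: "W \<in> borel_measurable P"
    and h: "nn_cond_exp_version P V W h" "\<And>v. h v \<le> B"
    and \<phi>: "\<phi> \<in> borel_measurable borel"
  shows "(\<integral>\<^sup>+w. \<phi> (V w) * W w \<partial>P) \<le> B * (\<integral>\<^sup>+w. \<phi> (V w) \<partial>P)"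
proof -
  interpret sigma_finite_subalgebra P "sigma_gen P V"
    by (rule sigma_finite_subalgebra_sigma_gen[OF P V])
  have "V \<in> measurable (sigma_gen P V) borel"
    by (intro measurable_vimage_algebra1) auto
  then have \<phi>V: "(\<lambda>w. \<phi> (V w)) \<in> borel_measurable (sigma_gen P V)"
    using \<phi> by (rule measurable_compose)
  have "(\<integral>\<^sup>+w. \<phi> (V w) * W w \<partial>P) = (\<integral>\<^sup>+w. \<phi> (V w) * nn_cond_exp P (sigma_gen P V) W w \<partial>P)"
    by (rule nn_cond_exp_intg[OF \<phi>V W, symmetric])
  also have "\<dots> \<le> (\<integral>\<^sup>+w. B * \<phi> (V w) \<partial>P)"
  proof (rule nn_integral_mono_AE)
    have "AE w in P. h (V w) = nn_cond_exp P (sigma_gen P V) W w"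
      using h(1) by (simp add: nn_cond_exp_version_def)
    then show "AE w in P. \<phi> (V w) * nn_cond_exp P (sigma_gen P V) W w \<le> B * \<phi> (V w)"
    proof eventually_elim
      case (elim w)
      then show ?case using h(2)[of "V w"] by (metis mult.commute mult_right_mono zero_le)
    qed
  qed
  also have "\<dots> = B * (\<integral>\<^sup>+w. \<phi> (V w) \<partial>P)"
    using measurable_compose[OF V \<phi>] by (rule nn_integral_cmult)
  finally show ?thesis .
qed

text \<open>Every set of the generated sigma-algebra is a preimage under \<open>V\<close>, so the
  zero function satisfies the defining integral identities of the conditional expectation.\<close>

lemma real_cond_exp_eq_0:
  assumes P: "prob_space P" and V: "V \<in> borel_measurable P" and k: "integrable P k"
    and zero: "\<And>S. S \<in> sets borel \<Longrightarrow> (\<integral>p. indicator S (V p) * k p \<partial>P) = 0"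
  shows "AE p in P. real_cond_exp P (sigma_gen P V) k p = 0"
proof -
  interpret sigma_finite_subalgebra P "sigma_gen P V"
    by (rule sigma_finite_subalgebra_sigma_gen[OF P V])
  show ?thesis
  proof (rule real_cond_exp_charact[OF _ k])
    fix A assume "A \<in> sets (sigma_gen P V)"
    then obtain S where S: "S \<in> sets borel" "A = V -` S \<inter> space P"
      by (auto simp: sets_vimage_algebra2)
    have "(LINT p:A|P. k p) = (\<integral>p. indicator S (V p) * k p \<partial>P)"
      unfolding set_lebesgue_integral_def S(2)
      by (intro Bochner_Integration.integral_cong) (auto simp: indicator_def)
    then show "(LINT p:A|P. k p) = (LINT p:A|P. 0)"
      using zero[OF S(1)] by (simp add: set_lebesgue_integral_def)
  qed auto
qed

section \<open>Integrals against a finite signed measure\<close>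

lemma sets_positive_variation [simp, measurable_cong]: "sets (positive_variation N \<mu>) = sets N"
  by (simp add: positive_variation_def sets.space_closed sets.sigma_sets_eq)

text \<open>\<open>m1\<close> and \<open>m2\<close> need not be mutually singular, so they may
  differ from the Jordan parts that enter \<open>signed_integral\<close>. The aim is that integrals
  against \<open>\<mu>\<close> can nevertheless be computed from them.\<close>

locale difference_of_measures =
  m1: finite_measure m1 + m2: finite_measure m2 for m1 m2 :: "'b measure" +
  fixes N :: "'b measure" and \<mu> :: "'b set \<Rightarrow> real"
  assumes sets [measurable_cong]: "sets m1 = sets N" "sets m2 = sets N"
    and diff: "\<And>A. \<mu> A = measure m1 A - measure m2 A"
begin

lemma swap: "difference_of_measures m2 m1 N (\<lambda>A. - \<mu> A)"
  by unfold_locales (auto simp: sets diff)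

lemma signed: "finite_signed_measure N \<mu>"
  unfolding finite_signed_measure_def diff
  by (intro allI impI sums_diff m1.finite_measure_UNION m2.finite_measure_UNION) (auto simp: sets)

text \<open>For \<open>B\<close> inside \<open>A\<close>, dropping the subtracted measure gives
  \<open>\<mu> B \<le> measure m1 B\<close>. Finiteness of the Jordan parts follows.\<close>

lemma emeasure_positive_variation_le:
  assumes "A \<in> sets N"
  shows "emeasure (positive_variation N \<mu>) A \<le> emeasure m1 A"
  unfolding emeasure_positive_variation[OF signed assms]
proof (intro SUP_least, clarify)
  fix B assume B: "B \<in> sets N" "B \<subseteq> A"
  have "ennreal (\<mu> B) \<le> ennreal (measure m1 B)" by (intro ennreal_leI) (simp add: diff)
  also have "\<dots> \<le> emeasure m1 A"
    unfolding m1.emeasure_eq_measure[symmetric] using B assms by (intro emeasure_mono) (auto simp: sets)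
  finally show "ennreal (\<mu> B) \<le> emeasure m1 A" .
qed

lemma finite_positive_variation: "finite_measure (positive_variation N \<mu>)"
proof
  have "emeasure (positive_variation N \<mu>) (space N) \<le> emeasure m1 (space N)"
    by (rule emeasure_positive_variation_le) simp
  moreover have "space (positive_variation N \<mu>) = space N"
    by (rule sets_eq_imp_space_eq) simp
  ultimately show "emeasure (positive_variation N \<mu>) (space (positive_variation N \<mu>)) \<noteq> \<infinity>"
    using m1.emeasure_finite by (auto simp: top_unique)
qed

text \<open>Passing from a subset \<open>B\<close> of \<open>A\<close> to its relative complement matches the two suprema:
  \<open>\<mu> B + m2 A = m1 A - \<mu> (A - B)\<close>.\<close>

lemma positive_variation_add_le:
  assumes A: "A \<in> sets N"
  shows "emeasure (positive_variation N \<mu>) A + emeasure m2 A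
    \<le> emeasure (positive_variation N (\<lambda>A. - \<mu> A)) A + emeasure m1 A"
proof -
  interpret S: difference_of_measures m2 m1 N "\<lambda>A. - \<mu> A" by (rule swap)
  let ?R = "emeasure (positive_variation N (\<lambda>A. - \<mu> A)) A + emeasure m1 A"
  have pos: "ennreal (\<mu> B) + emeasure m2 A \<le> ?R" if B: "B \<in> sets N" "B \<subseteq> A" "\<mu> B \<ge> 0" for B
  proof -
    have AB: "A - B \<in> sets N" using A B by auto
    have "\<mu> A = \<mu> B + \<mu> (A - B)"
      using finite_signed_measure_Un[OF signed B(1) AB] B(2) by (simp add: Un_absorb1)
    then have "\<mu> B + measure m2 A = - \<mu> (A - B) + measure m1 A" by (simp add: diff[of A])
    then have "ennreal (\<mu> B) + emeasure m2 A = ennreal (- \<mu> (A - B) + measure m1 A)"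
      using B by (simp add: m2.emeasure_eq_measure flip: ennreal_plus)
    \<comment> \<open>Only an inequality: \<open>ennreal\<close> truncates negative reals to 0, so
      the right side is larger when \<open>- \<mu> (A - B)\<close> is negative.\<close>
    also have "\<dots> \<le> ennreal (- \<mu> (A - B)) + ennreal (measure m1 A)"
    proof (cases "- \<mu> (A - B) \<ge> 0")
      case False
      then have "ennreal (- \<mu> (A - B) + measure m1 A) \<le> ennreal (measure m1 A)"
        by (intro ennreal_leI) simp
      then show ?thesis by (simp add: add_increasing)
    next
      case True
      then show ?thesis by (subst ennreal_plus) auto
    qed
    also have "\<dots> \<le> ?R"
      unfolding emeasure_positive_variation[OF S.signed A] m1.emeasure_eq_measure
      using AB by (intro add_right_mono SUP_upper) auto
    finally show ?thesis .
  qed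
  have "ennreal (\<mu> B) + emeasure m2 A \<le> ?R" if B: "B \<in> sets N" "B \<subseteq> A" for B
  proof (cases "\<mu> B \<ge> 0")
    case True
    then show ?thesis using pos B by blast
  next
    case False
    \<comment> \<open>A set of negative measure contributes 0 to the supremum, exactly as the empty
      set does.\<close>
    then have "ennreal (\<mu> B) = ennreal (\<mu> {})" by (simp add: ennreal_neg diff)
    then show ?thesis using pos[of "{}"] by (simp add: diff)
  qed
  moreover have "{B \<in> sets N. B \<subseteq> A} \<noteq> {}" by auto
  ultimately show ?thesis
    unfolding emeasure_positive_variation[OF signed A]
    by (subst ennreal_SUP_add_left[symmetric]) (auto intro!: SUP_least)
qed

text \<open>The reverse inequality is the same one with \<open>m1\<close> and \<open>m2\<close>
  exchanged. The sum form expresses equality of two differences without subtraction in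
  \<open>ennreal\<close>.\<close>

lemma positive_variation_add:
  assumes A: "A \<in> sets N"
  shows "emeasure (positive_variation N \<mu>) A + emeasure m2 A
    = emeasure (positive_variation N (\<lambda>A. - \<mu> A)) A + emeasure m1 A"
  using positive_variation_add_le[OF A]
    difference_of_measures.positive_variation_add_le[OF swap A] by simp

text \<open>The identity on sets passes to nonnegative functions through scalar multiples, sums and
  increasing limits.\<close>

lemma nn_integral_positive_variation_add:
  assumes "u \<in> borel_measurable N"
  shows "(\<integral>\<^sup>+x. u x \<partial>positive_variation N \<mu>) + (\<integral>\<^sup>+x. u x \<partial>m2)
    = (\<integral>\<^sup>+x. u x \<partial>positive_variation N (\<lambda>A. - \<mu> A)) + (\<integral>\<^sup>+x. u x \<partial>m1)"
  using assms
proof (induction rule: borel_measurable_induct)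
  case (cong f g)
  have sp: "space (positive_variation N \<mu>) = space N"
    "space (positive_variation N (\<lambda>A. - \<mu> A)) = space N" "space m1 = space N" "space m2 = space N"
    by (auto intro!: sets_eq_imp_space_eq simp: sets)
  have "integral\<^sup>N M f = integral\<^sup>N M g" if "space M = space N" for M
    using that cong(3) by (intro nn_integral_cong) simp
  then show ?case using cong.IH by (simp only: sp)
next
  case (set A)
  then show ?case using positive_variation_add[OF set] by (simp add: sets)
next
  case (mult u c)
  have "integral\<^sup>N M (\<lambda>x. c * u x) = c * integral\<^sup>N M u" if "sets M = sets N" for M
    using mult(2) that by (intro nn_integral_cmult) (simp cong: measurable_cong_sets)
  then show ?case using mult.IH by (simp only: sets sets_positive_variation flip: distrib_left)
next
  case (add u v)
  have "integral\<^sup>N M (\<lambda>x. v x + u x) = integral\<^sup>N M v + integral\<^sup>N M u" if "sets M = sets N" for M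
    using add.hyps(1,3) that by (intro nn_integral_add) (simp_all cong: measurable_cong_sets)
  then have "integral\<^sup>N M (\<lambda>x. v x + u x) + integral\<^sup>N M' (\<lambda>x. v x + u x)
      = (integral\<^sup>N M v + integral\<^sup>N M' v) + (integral\<^sup>N M u + integral\<^sup>N M' u)"
    if "sets M = sets N" "sets M' = sets N" for M M'
    using that by (simp add: ac_simps)
  then show ?case using add.IH by (simp only: sets sets_positive_variation)
next
  case (seq U)
  have inc: "incseq (\<lambda>i. integral\<^sup>N M (U i))" for M
    using \<open>incseq U\<close> by (auto simp: incseq_def le_fun_def intro!: nn_integral_mono)
  have "integral\<^sup>N M (SUP i. U i) = (SUP i. integral\<^sup>N M (U i))" if "sets M = sets N" for M
    using seq.hyps that unfolding SUP_apply[abs_def]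
    by (intro nn_integral_monotone_convergence_SUP) (simp_all cong: measurable_cong_sets)
  then have "integral\<^sup>N M (SUP i. U i) + integral\<^sup>N M' (SUP i. U i)
      = (SUP i. integral\<^sup>N M (U i) + integral\<^sup>N M' (U i))"
    if "sets M = sets N" "sets M' = sets N" for M M'
    using that by (simp only: ennreal_SUP_add[OF inc inc])
  then show ?case
    using seq.IH by (simp only: sets sets_positive_variation)
qed

text \<open>Boundedness makes all four integrals finite, so the identity for nonnegative functions
  can be rearranged into a difference. It is used for \<open>h + c\<close> and for the constant
  \<open>c\<close>, and the two are subtracted.\<close>

lemma signed_integral_eq:
  assumes h: "h \<in> borel_measurable N" and c: "\<And>x. \<bar>h x\<bar> \<le> c"
  shows "integrable m1 h" "integrable m2 h"
    and "signed_integral N \<mu> h = (\<integral>x. h x \<partial>m1) - (\<integral>x. h x \<partial>m2)"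
proof -
  interpret S: difference_of_measures m2 m1 N "\<lambda>A. - \<mu> A" by (rule swap)
  let ?P = "positive_variation N \<mu>" and ?Q = "positive_variation N (\<lambda>A. - \<mu> A)"
  interpret P: finite_measure ?P by (rule finite_positive_variation)
  interpret Q: finite_measure ?Q by (rule S.finite_positive_variation)
  have int: "integrable M g" if "finite_measure M" "sets M = sets N" "g \<in> borel_measurable N"
    "\<And>x. \<bar>g x\<bar> \<le> b" for M b and g :: "'b \<Rightarrow> real"
    using that by (intro finite_measure.integrable_const_bound[of M g b])
      (simp_all cong: measurable_cong_sets)
  have ints: "integrable ?P g" "integrable ?Q g" "integrable m1 g" "integrable m2 g"
    if "g \<in> borel_measurable N" "\<And>x. \<bar>g x\<bar> \<le> b" for b and g :: "'b \<Rightarrow> real"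
    using int[OF _ _ that] sets P.finite_measure_axioms Q.finite_measure_axioms
      m1.finite_measure_axioms m2.finite_measure_axioms by auto
  show "integrable m1 h" "integrable m2 h" using ints[OF h c] by auto
  have eq: "(\<integral>x. g x \<partial>?P) + (\<integral>x. g x \<partial>m2) = (\<integral>x. g x \<partial>?Q) + (\<integral>x. g x \<partial>m1)"
    if g: "g \<in> borel_measurable N" "\<And>x. \<bar>g x\<bar> \<le> b" "\<And>x. 0 \<le> g x" for b and g :: "'b \<Rightarrow> real"
  proof -
    have nn: "(\<integral>\<^sup>+x. ennreal (g x) \<partial>M) + (\<integral>\<^sup>+x. ennreal (g x) \<partial>M')
        = ennreal ((\<integral>x. g x \<partial>M) + (\<integral>x. g x \<partial>M'))" if "integrable M g" "integrable M' g" for M M'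
      using that g(3) by (subst (1 2) nn_integral_eq_integral) auto
    have "(\<lambda>x. ennreal (g x)) \<in> borel_measurable N" using g(1) by measurable
    from nn_integral_positive_variation_add[OF this]
    have "ennreal ((\<integral>x. g x \<partial>?P) + (\<integral>x. g x \<partial>m2)) = ennreal ((\<integral>x. g x \<partial>?Q) + (\<integral>x. g x \<partial>m1))"
      by (simp only: nn ints[OF g(1,2)])
    moreover have "0 \<le> (\<integral>x. g x \<partial>M) + (\<integral>x. g x \<partial>M')" for M M'
      using g(3) by (intro add_nonneg_nonneg) simp_all
    ultimately show ?thesis by (simp only: ennreal_inj)
  qed
  have b: "\<bar>h x + c\<bar> \<le> 2 * c" "0 \<le> h x + c" "\<bar>c\<bar> \<le> c" "0 \<le> c" for x using c[of x] by auto
  have m: "(\<lambda>x. h x + c) \<in> borel_measurable N" "(\<lambda>x. c) \<in> borel_measurable N" using h by auto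
  show "signed_integral N \<mu> h = (\<integral>x. h x \<partial>m1) - (\<integral>x. h x \<partial>m2)"
    using eq[OF m(1) b(1,2)] eq[OF m(2) b(3,4)] ints[OF h c] ints[OF m(2) b(3)]
    by (simp add: signed_integral_def Bochner_Integration.integral_add del: lebesgue_integral_const)
qed

end

text \<open>The measure with density \<open>k\<close>, pushed forward along \<open>z\<close>, is a
  finite signed measure that is nonzero at \<open>S\<close>. Universality supplies a unit element
  with positive integral against it.\<close>

lemma c0_universal_integral_nonzero:
  fixes z :: "'p \<Rightarrow> 'b::euclidean_space" and k :: "'p \<Rightarrow> real"
  assumes z [measurable]: "z \<in> borel_measurable P" and k: "integrable P k"
    and H: "\<And>\<omega>. \<omega> \<in> H \<Longrightarrow> \<omega> \<in> borel_measurable borel"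
    and univ: "c0_universal H ip K"
    and S: "S \<in> sets borel" "(\<integral>p. indicator S (z p) * k p \<partial>P) \<noteq> 0"
  obtains \<omega> where "\<omega> \<in> H" "ip_norm ip \<omega> = 1" "(\<integral>p. \<omega> (z p) * k p \<partial>P) \<noteq> 0"
proof -
  have [measurable]: "k \<in> borel_measurable P" using k by auto
  \<comment> \<open>The values \<open>s = 1\<close> and \<open>s = -1\<close> give the images of the
    positive and the negative part of \<open>k\<close>; one parametrized definition treats
    both.\<close>
  define part where "part s = distr (density P (\<lambda>p. ennreal (max 0 (s * k p)))) borel z" for s :: real
  have finite: "finite_measure (part s)" for s
  proof
    have "emeasure (part s) (space (part s)) = (\<integral>\<^sup>+p. ennreal (max 0 (s * k p)) \<partial>P)"
      by (simp add: part_def emeasure_distr emeasure_density cong: nn_integral_cong)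
    also have "\<dots> \<le> (\<integral>\<^sup>+p. ennreal (norm (s * k p)) \<partial>P)"
      by (intro nn_integral_mono ennreal_leI) auto
    also have "\<dots> < \<infinity>"
      using integrable_mult_right[OF k, of s] unfolding integrable_iff_bounded by blast
    finally show "emeasure (part s) (space (part s)) \<noteq> \<infinity>" by simp
  qed
  define \<nu> where "\<nu> A = measure (part 1) A - measure (part (-1)) A" for A
  interpret difference_of_measures "part 1" "part (-1)" borel \<nu>
    by (intro difference_of_measures.intro difference_of_measures_axioms.intro finite)
      (auto simp: part_def \<nu>_def)
  have integral: "integrable P (\<lambda>p. max 0 (s * k p) * g (z p))"
    "(\<integral>x. g x \<partial>part s) = (\<integral>p. max 0 (s * k p) * g (z p) \<partial>P)"
    if [measurable]: "g \<in> borel_measurable borel" and c: "\<And>x. \<bar>g x\<bar> \<le> c" for g c s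
  proof -
    show "(\<integral>x. g x \<partial>part s) = (\<integral>p. max 0 (s * k p) * g (z p) \<partial>P)"
      unfolding part_def
      by (subst integral_distr, simp, simp, subst integral_density) (simp_all del: ennreal_max_0)
    show "integrable P (\<lambda>p. max 0 (s * k p) * g (z p))"
    proof (rule Bochner_Integration.integrable_bound)
      show "integrable P (\<lambda>p. (\<bar>s\<bar> * c) * \<bar>k p\<bar>)" using k by simp
      have "\<bar>max 0 (s * k p) * g (z p)\<bar> \<le> \<bar>s\<bar> * c * \<bar>k p\<bar>" for p
      proof -
        have "\<bar>max 0 (s * k p)\<bar> \<le> \<bar>s\<bar> * \<bar>k p\<bar>" unfolding abs_mult[symmetric] by simp
        then have "\<bar>max 0 (s * k p)\<bar> * \<bar>g (z p)\<bar> \<le> (\<bar>s\<bar> * \<bar>k p\<bar>) * c"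
          using c by (intro mult_mono) auto
        then show ?thesis by (simp add: abs_mult ac_simps)
      qed
      then show "AE p in P. norm (max 0 (s * k p) * g (z p)) \<le> norm (\<bar>s\<bar> * c * \<bar>k p\<bar>)"
        unfolding real_norm_def by (intro AE_I2 order_trans[OF _ abs_ge_self])
    qed measurable
  qed
  \<comment> \<open>Pointwise, \<open>max 0 (k p) - max 0 (- k p) = k p\<close>.\<close>
  have diff_integral: "(\<integral>x. g x \<partial>part 1) - (\<integral>x. g x \<partial>part (-1)) = (\<integral>p. g (z p) * k p \<partial>P)"
    if g: "g \<in> borel_measurable borel" "\<And>x. \<bar>g x\<bar> \<le> c" for g c
    unfolding integral(2)[OF g]
    by (subst Bochner_Integration.integral_diff[OF integral(1)[OF g] integral(1)[OF g], symmetric])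
      (auto intro!: Bochner_Integration.integral_cong simp: max_def)
  have "\<nu> S \<noteq> 0"
    using diff_integral[of "indicator S" 1] S by (simp add: \<nu>_def part_def)
  then have "(SUP \<omega>\<in>{\<omega> \<in> H. ip_norm ip \<omega> = 1}. ereal (signed_integral borel \<nu> \<omega>)) > 0"
    using univ S(1) signed unfolding c0_universal_def by blast
  then obtain \<omega> where \<omega>: "\<omega> \<in> H" "ip_norm ip \<omega> = 1" "signed_integral borel \<nu> \<omega> > 0"
    by (auto simp: less_SUP_iff)
  obtain C where C: "\<And>x y. \<bar>K x y\<bar> \<le> C" using univ unfolding c0_universal_def by blast
  \<comment> \<open>Boundedness of \<open>\<omega>\<close> is what allows replacing the Jordan parts
    by \<open>part 1\<close> and \<open>part (-1)\<close>.\<close>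
  have bounded: "\<bar>\<omega> x\<bar> \<le> sqrt C * ip_norm ip \<omega>" for x
    using univ by (intro rkhs.abs_eval_le[of H ip K] C \<omega>(1)) (simp add: c0_universal_def)
  show ?thesis
    using that[OF \<omega>(1,2)] \<omega>(3) signed_integral_eq(3)[OF H[OF \<omega>(1)] bounded]
      diff_integral[OF H[OF \<omega>(1)] bounded] by simp
qed

section \<open>Kernel means of i.i.d. samples\<close>

text \<open>The blocks \<open>{i}\<close> and \<open>{j}\<close> are disjoint, so the restricted
  families are independent, and coordinate projections preserve this.\<close>

lemma (in prob_space) distr_indep_vars_pair:
  assumes indep: "indep_vars (\<lambda>_. N) W I" and ij: "i \<in> I" "j \<in> I" "i \<noteq> j"
  shows "distr M N (W i) \<Otimes>\<^sub>M distr M N (W j) = distr M (N \<Otimes>\<^sub>M N) (\<lambda>w. (W i w, W j w))"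
proof -
  have "indep_var N ((\<lambda>f. f i) \<circ> (\<lambda>w. restrict (\<lambda>i. W i w) {i})) N ((\<lambda>f. f j) \<circ> (\<lambda>w. restrict (\<lambda>i. W i w) {j}))"
    using ij by (intro indep_var_compose[OF indep_var_restrict[OF indep]] measurable_component_singleton) auto
  then have "indep_var N (W i) N (W j)" by (simp add: comp_def)
  then show ?thesis unfolding indep_var_distribution_eq by blast
qed

text \<open>\<open>W i\<close> are the observations, \<open>z\<close> extracts the point at which
  the kernel is placed, and \<open>h\<close> is its weight, later the product of the two true
  errors.\<close>

locale iid_kernel_mean = prob_space M + separable_rkhs H ip K
  for M :: "'a measure" and H :: "('b::topological_space \<Rightarrow> real) set" and ip K +
  fixes N P :: "'p measure" and W :: "nat \<Rightarrow> 'a \<Rightarrow> 'p" and z :: "'p \<Rightarrow> 'b" and h :: "'p \<Rightarrow> real"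
    and C :: real
  assumes indep: "indep_vars (\<lambda>_. N) W UNIV" and law: "\<And>i. distr M N (W i) = P"
    and H_measurable: "\<And>\<omega>. \<omega> \<in> H \<Longrightarrow> \<omega> \<in> borel_measurable borel"
    and z [measurable]: "z \<in> borel_measurable N" and h [measurable]: "h \<in> borel_measurable N"
    and square_integrable: "integrable P (\<lambda>p. (h p)\<^sup>2)"
    and kernel_bounded: "\<And>x y. \<bar>K x y\<bar> \<le> C"
begin

lemma W_measurable [measurable]: "W i \<in> measurable M N"
  using indep by (auto simp: indep_vars_def)

lemma sets_P [measurable_cong]: "sets P = sets N"
  using law[of 0] by (metis sets_distr)

sublocale P: prob_space P
  using prob_space_distr[OF W_measurable[of 0]] law[of 0] by simp

lemma integrable_W_iff:
  fixes g :: "'p \<Rightarrow> real"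
  assumes "g \<in> borel_measurable N"
  shows "integrable M (\<lambda>w. g (W i w)) \<longleftrightarrow> integrable P g"
  unfolding law[of i, symmetric] using assms by (intro integrable_distr_eq[symmetric]) auto

lemma integral_W:
  fixes g :: "'p \<Rightarrow> real"
  assumes "g \<in> borel_measurable N"
  shows "(\<integral>w. g (W i w) \<partial>M) = (\<integral>p. g p \<partial>P)"
  unfolding law[of i, symmetric] using assms by (intro integral_distr[symmetric]) auto

lemma integrable_h: "integrable P h"
  by (rule P.square_integrable_imp_integrable[OF _ square_integrable]) measurable

lemma H_z_measurable [measurable]: "\<omega> \<in> H \<Longrightarrow> (\<lambda>p. \<omega> (z p)) \<in> borel_measurable N"
  by (rule measurable_compose[OF z H_measurable])

lemma integrable_H_h:
  assumes "\<omega> \<in> H" shows "integrable P (\<lambda>p. \<omega> (z p) * h p)"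
proof (rule Bochner_Integration.integrable_bound)
  show "integrable P (\<lambda>p. (sqrt C * ip_norm ip \<omega>) * h p)"
    by (intro integrable_mult_right integrable_h)
  show "(\<lambda>p. \<omega> (z p) * h p) \<in> borel_measurable P" using assms by measurable
  show "AE p in P. norm (\<omega> (z p) * h p) \<le> norm (sqrt C * ip_norm ip \<omega> * h p)"
  proof (rule AE_I2)
    fix p
    have "\<bar>\<omega> (z p)\<bar> \<le> \<bar>sqrt C * ip_norm ip \<omega>\<bar>"
      using abs_eval_le[OF kernel_bounded assms, of "z p"] by linarith
    then show "norm (\<omega> (z p) * h p) \<le> norm (sqrt C * ip_norm ip \<omega> * h p)"
      unfolding real_norm_def abs_mult[of _ "h p"] by (intro mult_right_mono) auto
  qed
qed

text \<open>Bounded evaluation makes the integral a bounded functional of norm at most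
  \<open>sqrt C\<close> times the mean of \<open>\<bar>h p\<bar>\<close>, so Riesz representation
  applies.\<close>

lemma mean_embedding_exists: "\<exists>m\<in>H. \<forall>\<omega>\<in>H. ip \<omega> m = (\<integral>p. \<omega> (z p) * h p \<partial>P)"
proof -
  define L where "L \<omega> = (\<integral>p. \<omega> (z p) * h p \<partial>P)" for \<omega>
  obtain m where "m \<in> H" "\<And>\<omega>. \<omega> \<in> H \<Longrightarrow> ip \<omega> m = L \<omega>"
  proof (rule riesz_representation[of L "sqrt C * (\<integral>p. \<bar>h p\<bar> \<partial>P)"])
    fix \<omega> \<omega>' and c :: real
    assume \<omega>: "\<omega> \<in> H"
    show "L (\<lambda>x. c * \<omega> x) = c * L \<omega>" by (simp add: L_def mult.assoc)
    show "\<bar>L \<omega>\<bar> \<le> sqrt C * (\<integral>p. \<bar>h p\<bar> \<partial>P) * ip_norm ip \<omega>"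
    proof -
      have "\<bar>L \<omega>\<bar> \<le> (\<integral>p. \<bar>\<omega> (z p) * h p\<bar> \<partial>P)"
        unfolding L_def by (rule integral_abs_bound)
      also have "\<dots> \<le> (\<integral>p. (sqrt C * ip_norm ip \<omega>) * \<bar>h p\<bar> \<partial>P)"
        using abs_eval_le[OF kernel_bounded \<omega>] integrable_H_h[OF \<omega>] integrable_h
        by (intro integral_mono integrable_abs integrable_mult_right)
          (auto simp: abs_mult intro: mult_right_mono)
      finally show ?thesis by (simp add: ac_simps)
    qed
    assume \<omega>': "\<omega>' \<in> H"
    show "L (\<lambda>x. \<omega> x + \<omega>' x) = L \<omega> + L \<omega>'"
      using integrable_H_h[OF \<omega>] integrable_H_h[OF \<omega>'] by (simp add: L_def distrib_right)
  qed (rule that)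
  then show ?thesis unfolding L_def by blast
qed

text \<open>The kernel mean embedding of the signed measure with density \<open>h\<close>, that is,
  the expectation of \<open>h p\<close> times \<open>K (z p)\<close>. Defining it weakly avoids
  integrals with values in \<open>H\<close>.\<close>

definition mean_embedding :: "'b \<Rightarrow> real" where
  "mean_embedding = (SOME m. m \<in> H \<and> (\<forall>\<omega>\<in>H. ip \<omega> m = (\<integral>p. \<omega> (z p) * h p \<partial>P)))"

lemma mean_embedding_in: "mean_embedding \<in> H"
  and ip_mean_embedding: "\<omega> \<in> H \<Longrightarrow> ip \<omega> mean_embedding = (\<integral>p. \<omega> (z p) * h p \<partial>P)"
  using someI_ex[of "\<lambda>m. m \<in> H \<and> (\<forall>\<omega>\<in>H. ip \<omega> m = (\<integral>p. \<omega> (z p) * h p \<partial>P))"] mean_embedding_exists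
  unfolding mean_embedding_def by blast+

lemma K_measurable [measurable]:
  assumes "x \<in> borel_measurable Q" "y \<in> borel_measurable Q"
  shows "(\<lambda>w. K (x w) (y w)) \<in> borel_measurable Q"
  by (rule borel_measurable_kernel[OF H_measurable assms])

text \<open>The bound \<open>\<bar>a * b\<bar> \<le> a\<^sup>2 + b\<^sup>2\<close> uses no
  independence, so the diagonal pairs \<open>i = j\<close> are covered too.\<close>

lemma integrable_kernel_pair:
  "integrable M (\<lambda>w. h (W i w) * h (W j w) * K (z (W i w)) (z (W j w)))"
proof (rule Bochner_Integration.integrable_bound)
  show "integrable M (\<lambda>w. C * ((h (W i w))\<^sup>2 + (h (W j w))\<^sup>2))"
    using square_integrable integrable_W_iff[of "\<lambda>p. (h p)\<^sup>2"] by simp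
  show "(\<lambda>w. h (W i w) * h (W j w) * K (z (W i w)) (z (W j w))) \<in> borel_measurable M"
    by measurable
  have "\<bar>a * b * K x y\<bar> \<le> C * (a\<^sup>2 + b\<^sup>2)" for a b x y
  proof -
    have "0 \<le> (\<bar>a\<bar> - \<bar>b\<bar>)\<^sup>2" by simp
    then have "2 * (\<bar>a\<bar> * \<bar>b\<bar>) \<le> a\<^sup>2 + b\<^sup>2" by (simp add: power2_diff)
    moreover have "0 \<le> \<bar>a\<bar> * \<bar>b\<bar>" by simp
    ultimately have "\<bar>a * b\<bar> \<le> a\<^sup>2 + b\<^sup>2" unfolding abs_mult by linarith
    then have "\<bar>a * b\<bar> * \<bar>K x y\<bar> \<le> (a\<^sup>2 + b\<^sup>2) * C"
      by (intro mult_mono kernel_bounded) auto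
    then show ?thesis by (simp add: abs_mult mult.commute)
  qed
  then show "AE w in M. norm (h (W i w) * h (W j w) * K (z (W i w)) (z (W j w)))
      \<le> norm (C * ((h (W i w))\<^sup>2 + (h (W j w))\<^sup>2))"
    unfolding real_norm_def by (intro AE_I2 order_trans[OF _ abs_ge_self])
qed

text \<open>Independence and Fubini reduce this to an iterated integral. The inner one tests the
  embedding against \<open>K (z p)\<close> and so evaluates it at \<open>z p\<close>; the outer one
  tests the embedding against itself.\<close>

lemma integral_kernel_pair:
  assumes ij: "i \<noteq> j"
  shows "(\<integral>w. h (W i w) * h (W j w) * K (z (W i w)) (z (W j w)) \<partial>M)
    = ip mean_embedding mean_embedding"
proof -
  define F where "F q = h (fst q) * h (snd q) * K (z (fst q)) (z (snd q))" for q
  have F [measurable]: "F \<in> borel_measurable (N \<Otimes>\<^sub>M N)" unfolding F_def by measurable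
  interpret PP: pair_sigma_finite P P ..
  have PP: "P \<Otimes>\<^sub>M P = distr M (N \<Otimes>\<^sub>M N) (\<lambda>w. (W i w, W j w))"
    using distr_indep_vars_pair[OF indep _ _ ij] by (simp add: law)
  have int: "integrable (P \<Otimes>\<^sub>M P) F"
    unfolding PP using integrable_kernel_pair[of i j]
    by (subst integrable_distr_eq) (auto simp: F_def)
  have "(\<integral>w. h (W i w) * h (W j w) * K (z (W i w)) (z (W j w)) \<partial>M) = (\<integral>q. F q \<partial>(P \<Otimes>\<^sub>M P))"
    unfolding PP by (subst integral_distr) (auto simp: F_def)
  also have "\<dots> = (\<integral>p. (\<integral>p'. F (p, p') \<partial>P) \<partial>P)"
    by (rule PP.integral_fst'[OF int, symmetric])
  also have "\<dots> = (\<integral>p. mean_embedding (z p) * h p \<partial>P)"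
  proof (rule Bochner_Integration.integral_cong[OF refl])
    fix p
    have "(\<integral>p'. F (p, p') \<partial>P) = (\<integral>p'. h p * (K (z p) (z p') * h p') \<partial>P)"
      by (simp add: F_def ac_simps)
    also have "\<dots> = h p * ip (K (z p)) mean_embedding"
      by (simp add: ip_mean_embedding kernel_in)
    also have "ip (K (z p)) mean_embedding = mean_embedding (z p)"
      by (simp add: ip_commute[OF kernel_in mean_embedding_in] reproducing mean_embedding_in)
    finally show "(\<integral>p'. F (p, p') \<partial>P) = mean_embedding (z p) * h p" by simp
  qed
  also have "\<dots> = ip mean_embedding mean_embedding"
    by (rule ip_mean_embedding[OF mean_embedding_in, symmetric])
  finally show ?thesis .
qed

section \<open>Sample kernel means and their convergence\<close>

definition weighted_mean :: "(nat \<Rightarrow> nat \<Rightarrow> 'a \<Rightarrow> real) \<Rightarrow> nat \<Rightarrow> 'a \<Rightarrow> 'b \<Rightarrow> real" where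
  "weighted_mean a n w = kernel_comb n (\<lambda>i. a n i w / real n) (\<lambda>i. z (W i w))"

lemma weighted_mean_in: "weighted_mean a n w \<in> H"
  by (simp add: weighted_mean_def kernel_comb_in)

lemma ip_weighted_mean:
  "\<omega> \<in> H \<Longrightarrow> ip \<omega> (weighted_mean a n w) = (1 / real n) * (\<Sum>i<n. a n i w * \<omega> (z (W i w)))"
  by (simp add: weighted_mean_def ip_kernel_comb sum_distrib_left)

lemma borel_measurable_ip_weighted_mean:
  assumes a: "\<And>i. i < n \<Longrightarrow> a n i \<in> borel_measurable M" and \<omega>: "\<omega> \<in> H"
  shows "(\<lambda>w. ip \<omega> (weighted_mean a n w)) \<in> borel_measurable M"
  unfolding ip_weighted_mean[OF \<omega>] using a measurable_compose[OF W_measurable H_z_measurable[OF \<omega>]]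
  by (intro borel_measurable_times borel_measurable_sum) auto

lemma borel_measurable_weighted_mean_dist:
  assumes a: "\<And>i. i < n \<Longrightarrow> a n i \<in> borel_measurable M" and m: "m \<in> H"
  shows "(\<lambda>w. ip (\<lambda>x. weighted_mean a n w x - m x) (\<lambda>x. weighted_mean a n w x - m x))
    \<in> borel_measurable M"
proof (rule borel_measurable_ip_self)
  show "(\<lambda>x. weighted_mean a n w x - m x) \<in> H" for w
    by (intro diff_in weighted_mean_in m)
  fix d assume d: "d \<in> H"
  have "ip d (\<lambda>x. weighted_mean a n w x - m x) = ip d (weighted_mean a n w) + (-1) * ip d m" for w
    using ip_add_right[OF weighted_mean_in[of a n w] scale_in[OF m, of "-1"] d]
      ip_scale_right[OF m d, of "-1"] by simp
  then show "(\<lambda>w. ip d (\<lambda>x. weighted_mean a n w x - m x)) \<in> borel_measurable M"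
    using borel_measurable_ip_weighted_mean[where a = a and n = n, OF a d] by simp
qed

lemma borel_measurable_weighted_mean:
  assumes "\<And>i. i < n \<Longrightarrow> a n i \<in> borel_measurable M"
  shows "(\<lambda>w. ip (weighted_mean a n w) (weighted_mean a n w)) \<in> borel_measurable M"
  using borel_measurable_ip_weighted_mean[where a = a and n = n, OF assms] weighted_mean_in
  by (intro borel_measurable_ip_self) auto

text \<open>In the expanded squared distance the off-diagonal pairs have mean \<open>q\<close>, the
  diagonal ones \<open>b\<close>, and the cross and constant terms add up to \<open>- q\<close>. The
  expectation is therefore \<open>(b - q) / real n\<close>.\<close>

lemma empirical_mean_embedding_converges:
  "converges_in_prob M (\<lambda>n w. ip (\<lambda>x. weighted_mean (\<lambda>n i w. h (W i w)) n w x - mean_embedding x)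
     (\<lambda>x. weighted_mean (\<lambda>n i w. h (W i w)) n w x - mean_embedding x)) 0"
proof -
  define q where "q = ip mean_embedding mean_embedding"
  define b where "b = (\<integral>p. h p * h p * K (z p) (z p) \<partial>P)"
  define k where "k i j w = h (W i w) * h (W j w) * K (z (W i w)) (z (W j w))" for i j w
  define l where "l i w = mean_embedding (z (W i w)) * h (W i w)" for i w
  let ?u = "weighted_mean (\<lambda>n i w. h (W i w))"
  let ?D = "\<lambda>n w. ip (\<lambda>x. ?u n w x - mean_embedding x) (\<lambda>x. ?u n w x - mean_embedding x)"
  have D: "?D n w = (1 / (real n)\<^sup>2) * (\<Sum>i<n. \<Sum>j<n. k i j w) - (2 / real n) * (\<Sum>i<n. l i w) + q" for n w
  proof -
    have "ip (?u n w) (?u n w) = (1 / (real n)\<^sup>2) * (\<Sum>i<n. \<Sum>j<n. k i j w)"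
      unfolding weighted_mean_def ip_kernel_comb_self
      by (simp add: k_def sum_distrib_left power2_eq_square)
    moreover have "ip (?u n w) mean_embedding = (1 / real n) * (\<Sum>i<n. l i w)"
      by (simp add: ip_commute[OF weighted_mean_in mean_embedding_in]
          ip_weighted_mean[OF mean_embedding_in] l_def mult.commute)
    ultimately show ?thesis
      by (simp add: ip_minus[OF weighted_mean_in mean_embedding_in] q_def)
  qed
  have k_int: "integrable M (k i j)" for i j
    unfolding k_def[abs_def] by (rule integrable_kernel_pair)
  have k: "(\<integral>w. k i j w \<partial>M) = (if i = j then b else q)" for i j
  proof (cases "i = j")
    case True
    have "(\<lambda>p. h p * h p * K (z p) (z p)) \<in> borel_measurable N" by measurable
    from integral_W[OF this, of i] show ?thesis using True by (simp add: k_def b_def)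
  qed (simp add: k_def q_def integral_kernel_pair)
  have lm: "(\<lambda>p. mean_embedding (z p) * h p) \<in> borel_measurable N"
    using mean_embedding_in by measurable
  have l_int: "integrable M (l i)" for i
    unfolding l_def[abs_def] integrable_W_iff[OF lm] by (rule integrable_H_h[OF mean_embedding_in])
  have l: "(\<integral>w. l i w \<partial>M) = q" for i
    unfolding l_def integral_W[OF lm] q_def by (rule ip_mean_embedding[OF mean_embedding_in, symmetric])
  have int: "integrable M (?D n)" for n
    unfolding D using k_int l_int by auto
  \<comment> \<open>For \<open>n = 0\<close> the sample mean is the zero function and the distance
    is \<open>q\<close>, while the quotient is 0; hence the formula starts at 1.\<close>
  have E: "(\<integral>w. ?D n w \<partial>M) = (b - q) / real n" if n: "n \<ge> 1" for n
  proof -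
    have "(\<integral>w. ?D n w \<partial>M) = (1 / (real n)\<^sup>2) * (\<Sum>i<n. \<Sum>j<n. if i = j then b else q)
        - (2 / real n) * (\<Sum>i<n. q) + q"
      unfolding D using k_int l_int by (simp add: k l prob_space)
    also have "(\<Sum>i<n. \<Sum>j<n. if i = j then b else q) = real n * (real n * q + (b - q))"
    proof -
      have "(\<Sum>j<n. if i = j then b else q) = real n * q + (b - q)" if "i < n" for i
      proof -
        have "(\<Sum>j<n. if i = j then b else q) = (\<Sum>j<n. q + (if i = j then b - q else 0))"
          by (intro sum.cong) auto
        then show ?thesis using that by (simp add: sum.distrib)
      qed
      then show ?thesis by simp
    qed
    also have "(1 / (real n)\<^sup>2) * (real n * (real n * q + (b - q))) - (2 / real n) * (\<Sum>i<n. q) + q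
        = (b - q) / real n"
    proof -
      have "real n \<noteq> 0" using n by simp
      then have "(1 / (real n)\<^sup>2) * (real n * (real n * q + (b - q))) = q + (b - q) / real n"
        "(2 / real n) * (\<Sum>i<n. q) = 2 * q"
        by (simp_all add: add_divide_distrib power2_eq_square)
      then show ?thesis by simp
    qed
    finally show ?thesis .
  qed
  show ?thesis
  proof (rule converges_in_prob_if_mean_tendsto_0[OF finite_measure_axioms int])
    show "0 \<le> ?D n w" for n w by (intro ip_nonneg diff_in weighted_mean_in mean_embedding_in)
    have "(\<lambda>n. (b - q) / real n) \<longlonglongrightarrow> 0" by (rule lim_const_over_n)
    then show "(\<lambda>n. \<integral>w. ?D n w \<partial>M) \<longlonglongrightarrow> 0"
      by (rule Lim_transform_eventually) (use E in \<open>auto intro!: eventually_sequentiallyI[of 1]\<close>)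
  qed
qed

text \<open>The i.i.d. mean is an intermediate point: its distance to the embedding vanishes, and
  its distance to \<open>weighted_mean a\<close> is controlled by the mean absolute difference of
  the coefficients, thanks to the bounded kernel.\<close>

lemma weighted_mean_norm_converges:
  assumes a: "\<And>n i. i < n \<Longrightarrow> a n i \<in> borel_measurable M"
    and approx: "converges_in_prob M (\<lambda>n w. (1 / real n) * (\<Sum>i<n. \<bar>a n i w - h (W i w)\<bar>)) 0"
  shows "converges_in_prob M (\<lambda>n w. ip (weighted_mean a n w) (weighted_mean a n w))
    (ip mean_embedding mean_embedding)"
proof -
  let ?u = "weighted_mean (\<lambda>n i w. h (W i w))" and ?v = "weighted_mean a"
  let ?D = "\<lambda>v n w. ip (\<lambda>x. v n w x - mean_embedding x) (\<lambda>x. v n w x - mean_embedding x)"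
  let ?R = "\<lambda>n w. (1 / real n) * (\<Sum>i<n. \<bar>a n i w - h (W i w)\<bar>)"
  note fin = finite_measure_axioms
  have R: "ip (\<lambda>x. ?v n w x - ?u n w x) (\<lambda>x. ?v n w x - ?u n w x) \<le> C * (?R n w)\<^sup>2" for n w
  proof -
    have "(\<lambda>x. ?v n w x - ?u n w x)
        = kernel_comb n (\<lambda>i. a n i w / real n - h (W i w) / real n) (\<lambda>i. z (W i w))"
      unfolding weighted_mean_def by (rule kernel_comb_diff)
    moreover have "(\<Sum>i<n. \<bar>a n i w / real n - h (W i w) / real n\<bar>) = ?R n w"
      by (simp add: sum_distrib_left flip: diff_divide_distrib)
    moreover note ip_kernel_comb_le[OF kernel_bounded, of n
        "\<lambda>i. a n i w / real n - h (W i w) / real n" "\<lambda>i. z (W i w)"]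
    ultimately show ?thesis by (simp only:)
  qed
  have "converges_in_prob M (\<lambda>n w. 2 * C * (?R n w)\<^sup>2) (2 * C * 0\<^sup>2)"
    by (rule converges_in_prob_isCont[OF fin approx]) auto
  moreover have "converges_in_prob M (\<lambda>n w. 2 * ?D ?u n w) (2 * 0)"
    by (rule converges_in_prob_isCont[OF fin empirical_mean_embedding_converges]) auto
  ultimately have "converges_in_prob M (\<lambda>n w. 2 * C * (?R n w)\<^sup>2 + 2 * ?D ?u n w) (2 * C * 0\<^sup>2 + 2 * 0)"
    by (rule converges_in_prob_add[OF fin])
  then have "converges_in_prob M (\<lambda>n w. 2 * C * (?R n w)\<^sup>2 + 2 * ?D ?u n w) 0" by simp
  then have Dv: "converges_in_prob M (?D ?v) 0"
  proof (rule converges_in_prob_dominated[OF fin])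
    show "?D ?v n \<in> borel_measurable M" for n
      by (intro borel_measurable_weighted_mean_dist a mean_embedding_in)
    show "\<bar>?D ?v n w - 0\<bar> \<le> 2 * C * (?R n w)\<^sup>2 + 2 * ?D ?u n w" for n w
    proof -
      have "0 \<le> ?D ?v n w" by (intro ip_nonneg diff_in weighted_mean_in mean_embedding_in)
      moreover have "?D ?v n w \<le> 2 * ip (\<lambda>x. ?v n w x - ?u n w x) (\<lambda>x. ?v n w x - ?u n w x) + 2 * ?D ?u n w"
        by (rule ip_diff_le_sum[OF weighted_mean_in weighted_mean_in mean_embedding_in])
      ultimately show ?thesis using R[of n w] by linarith
    qed
  qed
  \<comment> \<open>From distances to norms: with \<open>d\<close> the difference, the squared norms
    differ by \<open>ip d d + 2 * ip d mean_embedding\<close>, and Cauchy-Schwarz bounds this by a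
    continuous function of \<open>ip d d\<close> that vanishes at 0.\<close>
  have "converges_in_prob M (\<lambda>n w. ?D ?v n w + 2 * (sqrt (?D ?v n w) * ip_norm ip mean_embedding))
      (0 + 2 * (sqrt 0 * ip_norm ip mean_embedding))"
    by (rule converges_in_prob_isCont[OF fin Dv]) (auto intro!: continuous_intros)
  then have "converges_in_prob M (\<lambda>n w. ?D ?v n w + 2 * (sqrt (?D ?v n w) * ip_norm ip mean_embedding)) 0"
    by simp
  then show ?thesis
  proof (rule converges_in_prob_dominated[OF fin])
    show "(\<lambda>w. ip (?v n w) (?v n w)) \<in> borel_measurable M" for n
      by (intro borel_measurable_weighted_mean a)
    fix n w
    define d where "d = (\<lambda>x. ?v n w x - mean_embedding x)"
    have d: "d \<in> H" unfolding d_def by (intro diff_in weighted_mean_in mean_embedding_in)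
    have "?v n w = (\<lambda>x. d x + 1 * mean_embedding x)" by (simp add: d_def)
    then have "ip (?v n w) (?v n w) = ip d d + 2 * ip d mean_embedding + ip mean_embedding mean_embedding"
      using ip_comb[OF d mean_embedding_in, of 1] by simp
    moreover have "\<bar>ip d mean_embedding\<bar> \<le> sqrt (ip d d) * ip_norm ip mean_embedding"
      using abs_ip_le[OF d mean_embedding_in] by (simp add: ip_norm_def)
    ultimately show "\<bar>ip (?v n w) (?v n w) - ip mean_embedding mean_embedding\<bar>
        \<le> ?D ?v n w + 2 * (sqrt (?D ?v n w) * ip_norm ip mean_embedding)"
      using ip_nonneg[OF d] unfolding d_def[symmetric] by linarith
  qed
qed

end

section \<open>The test statistic\<close>

text \<open>The difference of products is \<open>d * y + e * x + d * e\<close>. Cauchy-Schwarz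
  treats the two mixed sums, and \<open>\<bar>d * e\<bar> \<le> (d\<^sup>2 + e\<^sup>2) / 2\<close>
  the last one.\<close>

lemma product_perturbation_le:
  fixes x y d e :: "nat \<Rightarrow> real"
  shows "(1 / real n) * (\<Sum>i<n. \<bar>(x i + d i) * (y i + e i) - x i * y i\<bar>)
    \<le> sqrt (((1 / real n) * (\<Sum>i<n. (d i)\<^sup>2)) * ((1 / real n) * (\<Sum>i<n. (y i)\<^sup>2)))
      + sqrt (((1 / real n) * (\<Sum>i<n. (e i)\<^sup>2)) * ((1 / real n) * (\<Sum>i<n. (x i)\<^sup>2)))
      + ((1 / real n) * (\<Sum>i<n. (d i)\<^sup>2) + (1 / real n) * (\<Sum>i<n. (e i)\<^sup>2)) / 2"
proof -
  have cs: "(1 / real n) * (\<Sum>i<n. \<bar>u i\<bar> * \<bar>v i\<bar>)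
      \<le> sqrt (((1 / real n) * (\<Sum>i<n. (u i)\<^sup>2)) * ((1 / real n) * (\<Sum>i<n. (v i)\<^sup>2)))"
    for u v :: "nat \<Rightarrow> real"
  proof -
    have "(\<Sum>i<n. \<bar>u i\<bar> * \<bar>v i\<bar>) \<le> sqrt (\<Sum>i<n. (u i)\<^sup>2) * sqrt (\<Sum>i<n. (v i)\<^sup>2)"
      using L2_set_mult_ineq[of u v "{..<n}"] by (simp add: L2_set_def)
    then have "(1 / real n) * (\<Sum>i<n. \<bar>u i\<bar> * \<bar>v i\<bar>)
        \<le> (1 / real n) * (sqrt (\<Sum>i<n. (u i)\<^sup>2) * sqrt (\<Sum>i<n. (v i)\<^sup>2))"
      by (rule mult_left_mono) simp
    also have "\<dots> = sqrt (((1 / real n) * (\<Sum>i<n. (u i)\<^sup>2)) * ((1 / real n) * (\<Sum>i<n. (v i)\<^sup>2)))"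
      by (simp add: real_sqrt_mult real_sqrt_divide)
    finally show ?thesis .
  qed
  have "\<bar>(x i + d i) * (y i + e i) - x i * y i\<bar>
      \<le> \<bar>d i\<bar> * \<bar>y i\<bar> + \<bar>e i\<bar> * \<bar>x i\<bar> + ((d i)\<^sup>2 + (e i)\<^sup>2) / 2" for i
  proof -
    have "(x i + d i) * (y i + e i) - x i * y i = d i * y i + e i * x i + d i * e i"
      by (simp add: algebra_simps)
    moreover have "0 \<le> (\<bar>d i\<bar> - \<bar>e i\<bar>)\<^sup>2" by simp
    then have "\<bar>d i * e i\<bar> \<le> ((d i)\<^sup>2 + (e i)\<^sup>2) / 2" by (simp add: power2_diff abs_mult)
    ultimately show ?thesis unfolding abs_mult[symmetric] by linarith
  qed
  then have "(1 / real n) * (\<Sum>i<n. \<bar>(x i + d i) * (y i + e i) - x i * y i\<bar>)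
      \<le> (1 / real n) * (\<Sum>i<n. \<bar>d i\<bar> * \<bar>y i\<bar> + \<bar>e i\<bar> * \<bar>x i\<bar> + ((d i)\<^sup>2 + (e i)\<^sup>2) / 2)"
    by (intro mult_left_mono sum_mono) auto
  also have "\<dots> = (1 / real n) * (\<Sum>i<n. \<bar>d i\<bar> * \<bar>y i\<bar>) + (1 / real n) * (\<Sum>i<n. \<bar>e i\<bar> * \<bar>x i\<bar>)
      + ((1 / real n) * (\<Sum>i<n. (d i)\<^sup>2) + (1 / real n) * (\<Sum>i<n. (e i)\<^sup>2)) / 2"
    by (simp add: sum.distrib distrib_left add_divide_distrib flip: sum_divide_distrib)
  finally show ?thesis using cs[of d y] cs[of e x] by linarith
qed

lemma fitted_measurable:
  fixes Z :: "nat \<Rightarrow> 'a \<Rightarrow> 'z::second_countable_topology"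
  assumes m: "regression_estimator m" and i: "i < n"
    and [measurable]: "\<And>i. U i \<in> borel_measurable M" "\<And>i. Z i \<in> borel_measurable M"
  shows "fitted m U Z n i \<in> borel_measurable M"
proof -
  have "(\<lambda>w. (\<lambda>j\<in>{..<n}. (U j w, Z j w), Z i w)) \<in> measurable M ((\<Pi>\<^sub>M j\<in>{..<n}. borel) \<Otimes>\<^sub>M borel)"
    by (intro measurable_Pair measurable_restrict borel_measurable_Pair) auto
  moreover have "(\<lambda>(D, z). m n D z) \<in> borel_measurable ((\<Pi>\<^sub>M i\<in>{..<n}. borel) \<Otimes>\<^sub>M borel)"
    using m by (simp add: regression_estimator_def)
  ultimately have "(\<lambda>w. (\<lambda>(D, z). m n D z) (\<lambda>j\<in>{..<n}. (U j w, Z j w), Z i w)) \<in> borel_measurable M"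
    by (rule measurable_compose)
  then show ?thesis by (simp add: fitted_def[abs_def])
qed

text \<open>The rate is at most 1 for \<open>n \<ge> 1\<close>, so dividing by it only enlarges the
  error; for \<open>n = 0\<close> both sides vanish.\<close>

lemma mean_sq_error_converges:
  assumes M: "finite_measure M"
    and small: "small_o_p M (mean_sq_error h m U Z) (\<lambda>n. real n powr (- 1 / 2))"
    and meas: "\<And>n. mean_sq_error h m U Z n \<in> borel_measurable M"
  shows "converges_in_prob M (mean_sq_error h m U Z) 0"
proof -
  have "converges_in_prob M (\<lambda>n w. \<bar>mean_sq_error h m U Z n w / real n powr (- 1 / 2)\<bar>) \<bar>0\<bar>"
    using small unfolding small_o_p_def
    by (rule converges_in_prob_isCont[where \<phi> = abs, OF M]) (auto intro: continuous_intros)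
  then have "converges_in_prob M (\<lambda>n w. \<bar>mean_sq_error h m U Z n w / real n powr (- 1 / 2)\<bar>) 0"
    by simp
  then show ?thesis
  proof (rule converges_in_prob_dominated[OF M _ meas])
    fix n w
    show "\<bar>mean_sq_error h m U Z n w - 0\<bar> \<le> \<bar>mean_sq_error h m U Z n w / real n powr (- 1 / 2)\<bar>"
    proof (cases "n = 0")
      case False
      then have r: "0 < real n powr (- 1 / 2)" "real n powr (- 1 / 2) \<le> 1"
        using powr_mono[of "- 1 / 2" 0 "real n"] by auto
      then have "\<bar>mean_sq_error h m U Z n w\<bar> * real n powr (- 1 / 2) \<le> \<bar>mean_sq_error h m U Z n w\<bar>"
        by (simp add: mult_left_le)
      then show ?thesis using r by (simp add: abs_divide pos_le_divide_eq)
    qed (simp add: mean_sq_error_def)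
  qed
qed

lemma borel_measurable_coords:
  "coord_X \<in> borel_measurable borel" "coord_Y \<in> borel_measurable borel" "coord_Z \<in> borel_measurable borel"
  unfolding coord_X_def[abs_def] coord_Y_def[abs_def] coord_Z_def[abs_def]
  by (intro borel_measurable_continuous_onI continuous_intros)+

theorem theorem22:
  fixes M :: "'a measure"
    and X Y :: "nat \<Rightarrow> 'a \<Rightarrow> real"
    and Z :: "nat \<Rightarrow> 'a \<Rightarrow> real ^ 'd"
    and P :: "(real \<times> real \<times> (real ^ 'd)) measure"
    and H :: "(real ^ 'd \<Rightarrow> real) set"
    and ip :: "(real ^ 'd \<Rightarrow> real) \<Rightarrow> (real ^ 'd \<Rightarrow> real) \<Rightarrow> real"
    and K :: "real ^ 'd \<Rightarrow> real ^ 'd \<Rightarrow> real"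
    and f g :: "real ^ 'd \<Rightarrow> real"
    and fhat ghat :: "(real ^ 'd) estimator"
    and u_f v_g :: "real ^ 'd \<Rightarrow> real \<Rightarrow> ennreal"
  assumes "prob_space M"
    and iid: "prob_space.indep_vars M (\<lambda>_. borel) (\<lambda>i w. (X i w, Y i w, Z i w)) UNIV"
             "\<And>i. distr M borel (\<lambda>w. (X i w, Y i w, Z i w)) = P"
    and integrable: "integrable P coord_X" "integrable P coord_Y"
    and rkhs: "separable_rkhs H ip K" "\<And>\<omega>. \<omega> \<in> H \<Longrightarrow> \<omega> \<in> borel_measurable borel"
    and regression: "cond_exp_version P coord_Z coord_X f" "cond_exp_version P coord_Z coord_Y g"
    and estimators: "regression_estimator fhat" "regression_estimator ghat"
    and i: "small_o_p M (mean_sq_error f fhat X Z) (\<lambda>n. real n powr (- 1 / 2))"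
           "small_o_p M (mean_sq_error g ghat Y Z) (\<lambda>n. real n powr (- 1 / 2))"
    and ii: "nn_cond_exp_version P (\<lambda>p. (coord_Z p, coord_Y p)) (\<lambda>p. ennreal ((eps_X f p)\<^sup>2))
               (\<lambda>(z, y). u_f z y)"
            "nn_cond_exp_version P (\<lambda>p. (coord_Z p, coord_X p)) (\<lambda>p. ennreal ((eps_Y g p)\<^sup>2))
               (\<lambda>(z, x). v_g z x)"
            "\<exists>B::real. \<forall>z y. u_f z y \<le> ennreal B"
            "\<exists>B::real. \<forall>z x. v_g z x \<le> ennreal B"
    and iii: "0 < (\<integral>p. (eps_X f p)\<^sup>2 * (eps_Y g p)\<^sup>2 \<partial>P)"
    and iv: "\<exists>C>0. \<forall>z z'. \<bar>K z z'\<bar> \<le> C"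
    and alternative: "\<not> cond_indep P coord_X coord_Y coord_Z"
  shows "\<exists>c_star::real.
           converges_in_prob M (\<lambda>n w. (1 / real n) * sup_stat H ip fhat ghat X Y Z n w) (c_star\<^sup>2) \<and>
           ((\<exists>A \<in> sets borel.
               measure P {p \<in> space P. coord_Z p \<in> A} > 0 \<and>
               (AE p in P. coord_Z p \<in> A \<longrightarrow>
                  real_cond_exp P (sigma_gen P coord_Z) (\<lambda>p. eps_X f p * eps_Y g p) p \<noteq> 0)) \<longrightarrow>
            c0_universal H ip K \<longrightarrow>
            c_star \<noteq> 0)"
proof -

  \<comment> \<open>Measurability of the observations and errors\<close>
  interpret prob_space M by fact
  have sets_P [measurable_cong, simp]: "sets P = sets borel" using iid(2)[of 0] by (metis sets_distr)
  have W [measurable]: "(\<lambda>w. (X i w, Y i w, Z i w)) \<in> borel_measurable M" for i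
    using iid(1) by (auto simp: indep_vars_def)
  interpret P: prob_space P using prob_space_distr[OF W[of 0]] iid(2)[of 0] by simp
  have f [measurable]: "f \<in> borel_measurable borel" and g [measurable]: "g \<in> borel_measurable borel"
    using regression by (auto simp: cond_exp_version_def)
  note [measurable] = borel_measurable_coords
  have X [measurable]: "X i \<in> borel_measurable M" and Y [measurable]: "Y i \<in> borel_measurable M"
    and Z [measurable]: "Z i \<in> borel_measurable M" for i
    using measurable_compose[OF W borel_measurable_coords(1)] measurable_compose[OF W borel_measurable_coords(2)]
      measurable_compose[OF W borel_measurable_coords(3)]
    by (simp_all add: coord_X_def coord_Y_def coord_Z_def)
  have eps [measurable]: "eps_X f \<in> borel_measurable borel" "eps_Y g \<in> borel_measurable borel"
    unfolding eps_X_def[abs_def] eps_Y_def[abs_def] by measurable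
  define k where "k p = eps_X f p * eps_Y g p" for p
  have k_measurable [measurable]: "k \<in> borel_measurable borel" unfolding k_def[abs_def] by measurable
  obtain B1 B2 where B1: "\<And>z y. u_f z y \<le> ennreal B1" and B2: "\<And>z x. v_g z x \<le> ennreal B2"
    using ii(3,4) by blast
  obtain C where C: "\<And>x y. \<bar>K x y\<bar> \<le> C" using iv by blast

  \<comment> \<open>Second moments of the errors and of their product\<close>
  have ZX: "(\<lambda>p. (coord_Z p, coord_X p)) \<in> borel_measurable P"
    and ZY: "(\<lambda>p. (coord_Z p, coord_Y p)) \<in> borel_measurable P"
    by (intro borel_measurable_Pair; measurable)+
  have B1': "(case v of (z, y) \<Rightarrow> u_f z y) \<le> ennreal B1"
    and B2': "(case v of (z, x) \<Rightarrow> v_g z x) \<le> ennreal B2" for v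
    using B1 B2 by (auto split: prod.split)
  have epsX2: "(\<integral>\<^sup>+p. ennreal ((eps_X f p)\<^sup>2) \<partial>P) \<le> ennreal B1"
    using nn_integral_le_if_nn_cond_exp_le[OF P.prob_space_axioms ZY _ ii(1) B1', of "\<lambda>_. 1"]
    by (simp add: P.emeasure_space_1)
  have epsY2: "(\<integral>\<^sup>+p. ennreal ((eps_Y g p)\<^sup>2) \<partial>P) \<le> ennreal B2"
    using nn_integral_le_if_nn_cond_exp_le[OF P.prob_space_axioms ZX _ ii(2) B2', of "\<lambda>_. 1"]
    by (simp add: P.emeasure_space_1)
  \<comment> \<open>The squared error of \<open>Y\<close> is a function of \<open>(Z, Y)\<close>,
    hence an admissible weight when conditioning the squared error of \<open>X\<close> on that pair.
    This yields the bound \<open>B1 * B2\<close> for the mixed moment.\<close>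
  have "(\<lambda>v. ennreal ((snd v - g (fst v))\<^sup>2)) \<in> borel_measurable (borel :: ((real ^ 'd) \<times> real) measure)"
    unfolding borel_prod[symmetric] by measurable
  from nn_integral_le_if_nn_cond_exp_le[OF P.prob_space_axioms ZY _ ii(1) B1' this]
  have "(\<integral>\<^sup>+p. ennreal ((eps_Y g p)\<^sup>2) * ennreal ((eps_X f p)\<^sup>2) \<partial>P)
      \<le> ennreal B1 * (\<integral>\<^sup>+p. ennreal ((eps_Y g p)\<^sup>2) \<partial>P)"
    by (simp add: eps_Y_def)
  also have "\<dots> \<le> ennreal B1 * ennreal B2" by (intro mult_left_mono epsY2) simp
  finally have "(\<integral>\<^sup>+p. ennreal ((k p)\<^sup>2) \<partial>P) \<le> ennreal B1 * ennreal B2"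
    by (simp add: k_def power_mult_distrib mult.commute flip: ennreal_mult)
  then have k2: "integrable P (\<lambda>p. (k p)\<^sup>2)"
    unfolding integrable_iff_bounded by (auto simp: ennreal_mult_less_top intro: le_less_trans)
  have epsX2_int: "integrable P (\<lambda>p. (eps_X f p)\<^sup>2)" and epsY2_int: "integrable P (\<lambda>p. (eps_Y g p)\<^sup>2)"
    unfolding integrable_iff_bounded using epsX2 epsY2 by (auto intro: le_less_trans)

  \<comment> \<open>From here on \<open>mean_embedding\<close> represents
    \<open>\<omega> \<mapsto> E(\<omega>(Z) \<epsilon>_X \<epsilon>_Y)\<close>.\<close>
  interpret iid_kernel_mean M H ip K borel P "\<lambda>i w. (X i w, Y i w, Z i w)" coord_Z k C
    by (intro iid_kernel_mean.intro iid_kernel_mean_axioms.intro rkhs iid k2 C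
        prob_space_axioms borel_measurable_coords k_measurable)

  \<comment> \<open>The absolute value on the right covers \<open>n = 0\<close>, where the average
    is 0.\<close>
  have second_moment: "integrable M (\<lambda>w. (1 / real n) * (\<Sum>i<n. e (X i w, Y i w, Z i w)))"
      "(\<integral>w. (1 / real n) * (\<Sum>i<n. e (X i w, Y i w, Z i w)) \<partial>M) \<le> \<bar>\<integral>p. e p \<partial>P\<bar>"
    if e: "e \<in> borel_measurable borel" "integrable P e" for e n
  proof -
    have int: "integrable M (\<lambda>w. e (X i w, Y i w, Z i w))" for i
      using integrable_W_iff[OF e(1)] e(2) by simp
    then show "integrable M (\<lambda>w. (1 / real n) * (\<Sum>i<n. e (X i w, Y i w, Z i w)))" by simp
    have "(\<integral>w. (1 / real n) * (\<Sum>i<n. e (X i w, Y i w, Z i w)) \<partial>M) = (1 / real n) * (real n * (\<integral>p. e p \<partial>P))"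
      using int by (simp add: integral_W[OF e(1)])
    then show "(\<integral>w. (1 / real n) * (\<Sum>i<n. e (X i w, Y i w, Z i w)) \<partial>M) \<le> \<bar>\<integral>p. e p \<partial>P\<bar>"
      by (cases "n = 0") auto
  qed

  \<comment> \<open>Replacing the residuals by the true errors\<close>
  let ?fit = "fitted fhat X Z" and ?git = "fitted ghat Y Z"
  have fit [measurable]: "i < n \<Longrightarrow> ?fit n i \<in> borel_measurable M"
    and git [measurable]: "i < n \<Longrightarrow> ?git n i \<in> borel_measurable M" for n i
    using estimators by (auto intro: fitted_measurable)
  let ?Af = "mean_sq_error f fhat X Z" and ?Ag = "mean_sq_error g ghat Y Z"
  have Af_measurable: "?Af n \<in> borel_measurable M" and Ag_measurable: "?Ag n \<in> borel_measurable M" for n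
    unfolding mean_sq_error_def[abs_def]
    by (intro borel_measurable_times borel_measurable_const borel_measurable_sum borel_measurable_power
        borel_measurable_diff measurable_compose[OF Z f] measurable_compose[OF Z g] fit git; simp)+
  note fin = finite_measure_axioms
  note Af = mean_sq_error_converges[OF fin i(1) Af_measurable]
    and Ag = mean_sq_error_converges[OF fin i(2) Ag_measurable]
  define mX where "mX n w = (1 / real n) * (\<Sum>i<n. (eps_X f (X i w, Y i w, Z i w))\<^sup>2)" for n w
  define mY where "mY n w = (1 / real n) * (\<Sum>i<n. (eps_Y g (X i w, Y i w, Z i w))\<^sup>2)" for n w
  define a where "a n i w = residual fhat X Z n i w * residual ghat Y Z n i w" for n i w
  have a_measurable: "a n i \<in> borel_measurable M" if "i < n" for n i
    unfolding a_def[abs_def] residual_def[abs_def] using fit[OF that] git[OF that] by measurable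

  \<comment> \<open>The estimation error tends to 0 in probability, and \<open>mY\<close> has
    bounded mean by the second-moment bound.\<close>
  have Af_mY: "converges_in_prob M (\<lambda>n w. ?Af n w * mY n w) 0"
    unfolding mY_def
    by (rule converges_in_prob_mult_bounded_mean[OF fin Af second_moment(1) _ second_moment(2)])
      (auto simp: epsY2_int intro!: sum_nonneg divide_nonneg_nonneg)
  have Ag_mX: "converges_in_prob M (\<lambda>n w. ?Ag n w * mX n w) 0"
    unfolding mX_def
    by (rule converges_in_prob_mult_bounded_mean[OF fin Ag second_moment(1) _ second_moment(2)])
      (auto simp: epsX2_int intro!: sum_nonneg divide_nonneg_nonneg)
  have sqrt_lim: "converges_in_prob M (\<lambda>n w. sqrt (U n w)) 0" if "converges_in_prob M U 0" for U
    using converges_in_prob_isCont[OF fin that, of sqrt] by (simp add: isCont_real_sqrt)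
  have half: "converges_in_prob M (\<lambda>n w. (?Af n w + ?Ag n w) / 2) 0"
    using converges_in_prob_isCont[OF fin converges_in_prob_add[OF fin Af Ag], of "\<lambda>x. x / 2"] by simp
  have bound: "converges_in_prob M
      (\<lambda>n w. sqrt (?Af n w * mY n w) + sqrt (?Ag n w * mX n w) + (?Af n w + ?Ag n w) / 2) 0"
    using converges_in_prob_add[OF fin converges_in_prob_add[OF fin sqrt_lim[OF Af_mY] sqrt_lim[OF Ag_mX]] half]
    by simp
  have "converges_in_prob M (\<lambda>n w. (1 / real n) * (\<Sum>i<n. \<bar>a n i w - k (X i w, Y i w, Z i w)\<bar>)) 0"
  proof (rule converges_in_prob_dominated[OF fin bound])
    show "(\<lambda>w. (1 / real n) * (\<Sum>i<n. \<bar>a n i w - k (X i w, Y i w, Z i w)\<bar>)) \<in> borel_measurable M" for n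
      using a_measurable measurable_compose[OF W k_measurable]
      by (intro borel_measurable_times borel_measurable_sum borel_measurable_abs borel_measurable_diff) auto
    fix n w
    let ?x = "\<lambda>i. eps_X f (X i w, Y i w, Z i w)" and ?y = "\<lambda>i. eps_Y g (X i w, Y i w, Z i w)"
    let ?d = "\<lambda>i. f (Z i w) - ?fit n i w" and ?e = "\<lambda>i. g (Z i w) - ?git n i w"
    \<comment> \<open>Each residual is the true error plus the error of the regression
      estimate.\<close>
    have "a n i w = (?x i + ?d i) * (?y i + ?e i)" for i
      by (simp add: a_def residual_def eps_X_def eps_Y_def coord_X_def coord_Y_def coord_Z_def)
    then have "(1 / real n) * (\<Sum>i<n. \<bar>a n i w - k (X i w, Y i w, Z i w)\<bar>)
        = (1 / real n) * (\<Sum>i<n. \<bar>(?x i + ?d i) * (?y i + ?e i) - ?x i * ?y i\<bar>)"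
      by (simp only: k_def)
    also have "\<dots> \<le> sqrt (?Af n w * mY n w) + sqrt (?Ag n w * mX n w) + (?Af n w + ?Ag n w) / 2"
      unfolding mean_sq_error_def mX_def mY_def by (rule product_perturbation_le)
    finally show "\<bar>(1 / real n) * (\<Sum>i<n. \<bar>a n i w - k (X i w, Y i w, Z i w)\<bar>) - 0\<bar>
        \<le> sqrt (?Af n w * mY n w) + sqrt (?Ag n w * mX n w) + (?Af n w + ?Ag n w) / 2"
      by (simp add: sum_nonneg)
  qed
  from weighted_mean_norm_converges[of a, OF a_measurable this]
  have lim: "converges_in_prob M (\<lambda>n w. ip (weighted_mean a n w) (weighted_mean a n w))
      ((ip_norm ip mean_embedding)\<^sup>2)"
    by (simp add: ip_norm_square mean_embedding_in)

  \<comment> \<open>The statistic as a squared norm\<close>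
  have stat: "(weighted_stat fhat ghat X Y Z \<omega> n w)\<^sup>2 = real n * (ip \<omega> (weighted_mean a n w))\<^sup>2"
    if "\<omega> \<in> H" for \<omega> n w
  proof (cases "n = 0")
    case False
    have "weighted_stat fhat ghat X Y Z \<omega> n w = (1 / sqrt (real n)) * (real n * ip \<omega> (weighted_mean a n w))"
      using False by (simp add: ip_weighted_mean[OF that] weighted_stat_def a_def coord_Z_def ac_simps)
    then show ?thesis by (simp add: power_mult_distrib power_divide power2_eq_square)
  qed (simp add: weighted_stat_def)

  have limit: "converges_in_prob M (\<lambda>n w. (1 / real n) * sup_stat H ip fhat ghat X Y Z n w)
      ((ip_norm ip mean_embedding)\<^sup>2)"
  proof (cases "{\<omega> \<in> H. ip_norm ip \<omega> = 1} = {}")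
    case True
    then have "ip mean_embedding mean_embedding = 0"
      using normalize_in_sphere[OF mean_embedding_in] by blast
    then have 0: "ip_norm ip mean_embedding = 0" by (simp add: ip_norm_def)
    \<comment> \<open>Without unit vectors the supremum is the fixed real default
      \<open>Sup {}\<close>; divided by \<open>n\<close> it tends to 0, which is the squared norm of
      the embedding in the trivial space.\<close>
    have "sup_stat H ip fhat ghat X Y Z n w = Sup {}" for n w
      unfolding sup_stat_def True by simp
    moreover have "(\<lambda>n. (1 / real n) * Sup {}) \<longlonglongrightarrow> (0 :: real)"
      using lim_const_over_n[of "Sup {} :: real"] by simp
    ultimately show ?thesis using converges_in_prob_const[OF fin] 0 by simp
  next
    case False
    have "(1 / real n) * sup_stat H ip fhat ghat X Y Z n w
        = ip (weighted_mean a n w) (weighted_mean a n w)" for n w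
    proof -
      have "sup_stat H ip fhat ghat X Y Z n w
          = (SUP \<omega>\<in>{\<omega> \<in> H. ip_norm ip \<omega> = 1}. real n * (ip \<omega> (weighted_mean a n w))\<^sup>2)"
        unfolding sup_stat_def by (intro SUP_cong refl) (simp add: stat)
      also have "\<dots> = real n * ip (weighted_mean a n w) (weighted_mean a n w)"
        by (rule SUP_sphere_ip[OF weighted_mean_in False]) simp
      finally have eq: "sup_stat H ip fhat ghat X Y Z n w
          = real n * ip (weighted_mean a n w) (weighted_mean a n w)" .
      show ?thesis
      \<comment> \<open>For \<open>n = 0\<close> the factor \<open>1 / real n\<close> is 0, and so
        is the empty kernel combination.\<close>
      proof (cases "n = 0")
        case True
        then show ?thesis by (simp add: weighted_mean_def ip_kernel_comb_self)
      qed (simp add: eq)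
    qed
    then show ?thesis using lim by simp
  qed

  \<comment> \<open>Nonvanishing of the limit under universality\<close>
  have nonzero: "ip_norm ip mean_embedding \<noteq> 0"
    if A: "A \<in> sets borel" "measure P {p \<in> space P. coord_Z p \<in> A} > 0"
      "AE p in P. coord_Z p \<in> A \<longrightarrow>
        real_cond_exp P (sigma_gen P coord_Z) (\<lambda>p. eps_X f p * eps_Y g p) p \<noteq> 0"
      and univ: "c0_universal H ip K" for A
  proof -
    have Z_P: "coord_Z \<in> borel_measurable P" by measurable
    \<comment> \<open>Otherwise the conditional mean of the error product would vanish almost
      everywhere, contradicting the positive probability of \<open>A\<close>.\<close>
    have "\<exists>S\<in>sets borel. (\<integral>p. indicator S (coord_Z p) * k p \<partial>P) \<noteq> 0"
    proof (rule ccontr)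
      assume "\<not> (\<exists>S\<in>sets borel. (\<integral>p. indicator S (coord_Z p) * k p \<partial>P) \<noteq> 0)"
      then have "AE p in P. real_cond_exp P (sigma_gen P coord_Z) k p = 0"
        by (intro real_cond_exp_eq_0[OF P.prob_space_axioms Z_P integrable_h]) auto
      with A(3)[folded k_def] have "AE p in P. coord_Z p \<notin> A" by eventually_elim auto
      then have "measure P {p \<in> space P. coord_Z p \<in> A} = 0"
        using measurable_sets[OF Z_P A(1)] by (subst P.prob_eq_0) (auto simp: vimage_def Int_def conj_commute)
      then show False using A(2) by simp
    qed
    then obtain S where "S \<in> sets borel" "(\<integral>p. indicator S (coord_Z p) * k p \<partial>P) \<noteq> 0" by blast
    from c0_universal_integral_nonzero[OF Z_P integrable_h rkhs(2) univ this]
    obtain \<omega> where \<omega>: "\<omega> \<in> H" "ip_norm ip \<omega> = 1" "(\<integral>p. \<omega> (coord_Z p) * k p \<partial>P) \<noteq> 0"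
      by blast
    \<comment> \<open>The left side is the absolute value of the nonzero integral found above, so
      the norm is positive.\<close>
    have "\<bar>ip \<omega> mean_embedding\<bar> \<le> ip_norm ip mean_embedding"
      using abs_ip_le[OF \<omega>(1) mean_embedding_in] \<omega>(2) by simp
    then show ?thesis using \<omega>(3) ip_mean_embedding[OF \<omega>(1)] by auto
  qed
  show ?thesis
  proof (intro exI conjI impI)
    show "converges_in_prob M (\<lambda>n w. (1 / real n) * sup_stat H ip fhat ghat X Y Z n w)
        ((ip_norm ip mean_embedding)\<^sup>2)"
      by (rule limit)
    assume "\<exists>A\<in>sets borel. measure P {p \<in> space P. coord_Z p \<in> A} > 0 \<and>
        (AE p in P. coord_Z p \<in> A \<longrightarrow>
          real_cond_exp P (sigma_gen P coord_Z) (\<lambda>p. eps_X f p * eps_Y g p) p \<noteq> 0)"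
      and univ: "c0_universal H ip K"
    then show "ip_norm ip mean_embedding \<noteq> 0"
      by (elim bexE conjE) (rule nonzero)
  qed
qed

end
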